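(* Assume $\sigma_L^2=\sigma_R^2=:\sigma^2>0$. Let $c\in\mathbb{R}$ and let $\varphi:\mathbb{R}\to\mathbb{R}$ be continuous with finite limits at $\pm\infty$, symmetric with centre $c$ (i.e. $\varphi(x+c)=\varphi(-x+c)$ for all $x\in\mathbb{R}$), and monotone on $(c,\infty)$. Then: (1) If $(\mu_L,\mu_R)=(\overline{\mu},\underline{\mu})$, then $$\lim_{n\to\infty}E_P\left[\varphi\left(T_{n,n}^{\theta^{n,c}}\right)\right]=E_P[\varphi(\eta_1)],\qquad \eta_1\sim\mathcal{B}\left(\tfrac{\underline{\mu}-\overline{\mu}}{2},\tfrac{\overline{\mu}+\underline{\mu}}{2},c\right).$$ (2) If $(\mu_L,\mu_R)=(\underline{\mu},\overline{\mu})$, then $$\lim_{n\to\infty}E_P\left[\varphi\left(T_{n,n}^{\theta^{n,c}}\right)\right]=E_P[\varphi(\eta_2)],\qquad \eta_2\sim\mathcal{B}\left(\tfrac{\overline{\mu}-\underline{\mu}}{2},\tfrac{\overline{\mu}+\underline{\mu}}{2},c\right).$$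
   Context: Setting (two-armed bandit). Let $(\Omega,\mathcal{F},P)$ be a probability space and $W^L,W^R$ real random variables with finite means $\mu_L,\mu_R$ and finite variances $\sigma_L^2,\sigma_R^2$. Let $\{W_i^L\}_{i\ge1}$ and $\{W_i^R\}_{i\ge1}$ be sequences of i.i.d. copies of $W^L$ and $W^R$ respectively, the two sequences being independent of each other. Put $\overline{\mu}=\max\{\mu_L,\mu_R\}$, $\underline{\mu}=\min\{\mu_L,\mu_R\}$. A sampling strategy is a sequence $\theta=(\vartheta_1,\vartheta_2,\dots)$ of $\{1,2\}$-valued random variables; the reward at round $i$ is $Z_i^{\theta}=W_i^L$ if $\vartheta_i=1$ and $Z_i^\theta=W_i^R$ if $\vartheta_i=2$. Let $\mathcal{H}_n^{\theta}=\sigma\{Z_1^{\theta},\dots,Z_n^{\theta}\}$, $\mathcal{H}_0^{\theta}=\{\emptyset,\Omega\}$. The strategy $\theta$ is admissible if $\vartheta_n$ is $\mathcal{H}_{n-1}^{\theta}$-measurable for all $n\ge1$; $\Theta$ is the set of all admissible strategies. With $\sigma$ the common standard deviation, for $\theta\in\Theta$, $n\ge1$ and $1\le m\le n$, $$T_{m,n}^{\theta}=\frac1n\sum_{i=1}^{m}Z_i^{\theta}+\frac1{\sqrt n}\sum_{i=1}^{m}\frac1\sigma\left(Z_i^{\theta}-E_P[Z_i^{\theta}|\mathcal{H}_{i-1}^{\theta}]\right),\qquad T_{0,n}^{\theta}=0.$$ For $n\ge1$, $c\in\mathbb{R}$, the strategy $\theta^{n,c}=(\vartheta_1^{n,c},\vartheta_2^{n,c},\dots)$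 is defined recursively: $\vartheta_m^{n,c}=1$ if $T_{m-1,n}^{\theta^{n,c}}\le c-\left(1-\frac{m-1}{n}\right)\frac{\overline{\mu}+\underline{\mu}}{2}$, and $\vartheta_m^{n,c}=2$ otherwise (only rounds $m\le n$ matter here). Bandit distribution: $\eta\sim\mathcal{B}(\alpha,\beta,c)$, $(\alpha,\beta,c)\in\mathbb{R}^3$, means that $\eta$ has density $$f^{\alpha,\beta,c}(y)=\frac1{\sqrt{2\pi}}e^{-\frac{(y-\beta)^2-2\alpha(|y-c|-|c-\beta|)+\alpha^2}{2}}-\alpha e^{2\alpha|y-c|}\,\Phi(-|c-\beta|-|y-c|-\alpha),$$ where $\Phi$ is the standard normal distribution function. *)

theory Defs
  imports "HOL-Probability.Probability"
begin

text \<open>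
  The rounds of the bandit are numbered from 1, so sequences are functions on \<^typ>\<open>nat\<close> whose
  value at 0 is irrelevant. Independence of the two sequences is independence of the two random
  elements of the product space over the index set \<open>{1..}\<close>.
\<close>

locale two_armed_bandit = prob_space M
  for M :: "'a measure" +
  fixes WL WR :: "'a \<Rightarrow> real" and XL XR :: "nat \<Rightarrow> 'a \<Rightarrow> real"
  assumes WL_rv: "random_variable borel WL"
    and WR_rv: "random_variable borel WR"
    and WL_mean: "integrable M WL"
    and WR_mean: "integrable M WR"
    and WL_var: "integrable M (\<lambda>\<omega>. (WL \<omega>)\<^sup>2)"
    and WR_var: "integrable M (\<lambda>\<omega>. (WR \<omega>)\<^sup>2)"
    and XL_indep: "indep_vars (\<lambda>_. borel) XL {1..}"
    and XR_indep: "indep_vars (\<lambda>_. borel) XR {1..}"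
    and XL_copies: "\<And>i. 1 \<le> i \<Longrightarrow> distr M borel (XL i) = distr M borel WL"
    and XR_copies: "\<And>i. 1 \<le> i \<Longrightarrow> distr M borel (XR i) = distr M borel WR"
    and XL_XR_indep:
      "indep_var (Pi\<^sub>M {1..} (\<lambda>_. borel)) (\<lambda>\<omega>. \<lambda>i\<in>{1..}. XL i \<omega>)
                 (Pi\<^sub>M {1..} (\<lambda>_. borel)) (\<lambda>\<omega>. \<lambda>i\<in>{1..}. XR i \<omega>)"

definition reward ::
  "(nat \<Rightarrow> 'a \<Rightarrow> real) \<Rightarrow> (nat \<Rightarrow> 'a \<Rightarrow> real) \<Rightarrow> (nat \<Rightarrow> 'a \<Rightarrow> nat) \<Rightarrow> nat \<Rightarrow> 'a \<Rightarrow> real"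
where
  "reward XL XR \<theta> i \<omega> = (if \<theta> i \<omega> = 1 then XL i \<omega> else XR i \<omega>)"

definition history ::
  "'a measure \<Rightarrow> (nat \<Rightarrow> 'a \<Rightarrow> real) \<Rightarrow> (nat \<Rightarrow> 'a \<Rightarrow> real) \<Rightarrow> (nat \<Rightarrow> 'a \<Rightarrow> nat) \<Rightarrow> nat \<Rightarrow> 'a measure"
where
  "history M XL XR \<theta> n =
     sigma (space M)
       (\<Union>i\<in>{1..n}. {reward XL XR \<theta> i -` A \<inter> space M | A. A \<in> sets borel})"

definition admissible ::
  "'a measure \<Rightarrow> (nat \<Rightarrow> 'a \<Rightarrow> real) \<Rightarrow> (nat \<Rightarrow> 'a \<Rightarrow> real) \<Rightarrow> (nat \<Rightarrow> 'a \<Rightarrow> nat) \<Rightarrow> bool"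
where
  "admissible M XL XR \<theta> \<longleftrightarrow>
     (\<forall>n\<ge>1. \<theta> n \<in> measurable (history M XL XR \<theta> (n - 1)) (count_space {1, 2}))"

definition bandit_stat ::
  "'a measure \<Rightarrow> (nat \<Rightarrow> 'a \<Rightarrow> real) \<Rightarrow> (nat \<Rightarrow> 'a \<Rightarrow> real) \<Rightarrow> real \<Rightarrow> (nat \<Rightarrow> 'a \<Rightarrow> nat)
     \<Rightarrow> nat \<Rightarrow> nat \<Rightarrow> 'a \<Rightarrow> real"
where
  "bandit_stat M XL XR \<sigma> \<theta> m n \<omega> =
     1 / real n * (\<Sum>i=1..m. reward XL XR \<theta> i \<omega>) +
     1 / sqrt (real n) * (\<Sum>i=1..m. 1 / \<sigma> *
       (reward XL XR \<theta> i \<omega> -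
        real_cond_exp M (history M XL XR \<theta> (i - 1)) (reward XL XR \<theta> i) \<omega>))"

text \<open>
  The strategy \<open>\<theta>\<^sup>n\<^sup>,\<^sup>c\<close> refers in round \<open>m\<close> to its own rounds \<open>1, \<dots>, m - 1\<close>. The auxiliary function
  builds the first \<open>m\<close> rounds (the rest is a dummy); the strategy itself is the diagonal, and it
  satisfies the defining recursion (\<open>threshold_strategy_rec\<close>).
\<close>

primrec threshold_strategy_upto ::
  "'a measure \<Rightarrow> (nat \<Rightarrow> 'a \<Rightarrow> real) \<Rightarrow> (nat \<Rightarrow> 'a \<Rightarrow> real) \<Rightarrow> real \<Rightarrow> real \<Rightarrow> real \<Rightarrow> nat \<Rightarrow> real
     \<Rightarrow> nat \<Rightarrow> (nat \<Rightarrow> 'a \<Rightarrow> nat)"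
where
  "threshold_strategy_upto M XL XR \<sigma> \<mu>hi \<mu>lo n c 0 = (\<lambda>_ _. 1)"
| "threshold_strategy_upto M XL XR \<sigma> \<mu>hi \<mu>lo n c (Suc m) =
     (threshold_strategy_upto M XL XR \<sigma> \<mu>hi \<mu>lo n c m)
       (Suc m := \<lambda>\<omega>.
          if bandit_stat M XL XR \<sigma> (threshold_strategy_upto M XL XR \<sigma> \<mu>hi \<mu>lo n c m) m n \<omega>
             \<le> c - (1 - real m / real n) * ((\<mu>hi + \<mu>lo) / 2)
          then 1 else 2)"

definition threshold_strategy ::
  "'a measure \<Rightarrow> (nat \<Rightarrow> 'a \<Rightarrow> real) \<Rightarrow> (nat \<Rightarrow> 'a \<Rightarrow> real) \<Rightarrow> real \<Rightarrow> real \<Rightarrow> real \<Rightarrow> nat \<Rightarrow> real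
     \<Rightarrow> nat \<Rightarrow> 'a \<Rightarrow> nat"
where
  "threshold_strategy M XL XR \<sigma> \<mu>hi \<mu>lo n c m =
     threshold_strategy_upto M XL XR \<sigma> \<mu>hi \<mu>lo n c m m"

lemma reward_cong: "\<theta> i = \<theta>' i \<Longrightarrow> reward XL XR \<theta> i = reward XL XR \<theta>' i"
  by (simp add: reward_def fun_eq_iff)

lemma history_cong:
  assumes "\<And>i. 1 \<le> i \<Longrightarrow> i \<le> n \<Longrightarrow> \<theta> i = \<theta>' i"
  shows "history M XL XR \<theta> n = history M XL XR \<theta>' n"
proof -
  have "reward XL XR \<theta> i = reward XL XR \<theta>' i" if "i \<in> {1..n}" for i
    using that assms by (auto intro!: reward_cong)
  then have "(\<Union>i\<in>{1..n}. {reward XL XR \<theta> i -` A \<inter> space M | A. A \<in> sets borel}) =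
             (\<Union>i\<in>{1..n}. {reward XL XR \<theta>' i -` A \<inter> space M | A. A \<in> sets borel})"
    by (intro SUP_cong) auto
  then show ?thesis
    by (simp add: history_def)
qed

lemma bandit_stat_cong:
  assumes "\<And>i. 1 \<le> i \<Longrightarrow> i \<le> m \<Longrightarrow> \<theta> i = \<theta>' i"
  shows "bandit_stat M XL XR \<sigma> \<theta> m n = bandit_stat M XL XR \<sigma> \<theta>' m n"
proof -
  have r: "reward XL XR \<theta> i = reward XL XR \<theta>' i" if "i \<in> {1..m}" for i
    using that assms by (auto intro!: reward_cong)
  have h: "history M XL XR \<theta> (i - 1) = history M XL XR \<theta>' (i - 1)" if "i \<in> {1..m}" for i
    using that assms by (intro history_cong) auto
  show ?thesis
    unfolding bandit_stat_def fun_eq_iff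
    by (intro allI arg_cong2[where f="(+)"] arg_cong2[where f="(*)"] refl sum.cong)
       (simp_all only: r h)
qed

lemma threshold_strategy_upto_eq:
  "i \<le> m \<Longrightarrow> threshold_strategy_upto M XL XR \<sigma> \<mu>hi \<mu>lo n c m i =
    threshold_strategy M XL XR \<sigma> \<mu>hi \<mu>lo n c i"
  by (induction m) (auto simp: threshold_strategy_def le_Suc_eq)

lemma threshold_strategy_rec:
  assumes "1 \<le> m"
  shows "threshold_strategy M XL XR \<sigma> \<mu>hi \<mu>lo n c m \<omega> =
    (if bandit_stat M XL XR \<sigma> (threshold_strategy M XL XR \<sigma> \<mu>hi \<mu>lo n c) (m - 1) n \<omega>
        \<le> c - (1 - real (m - 1) / real n) * ((\<mu>hi + \<mu>lo) / 2)
     then 1 else 2)"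
proof -
  obtain k where k: "m = Suc k"
    using assms by (cases m) auto
  have "bandit_stat M XL XR \<sigma> (threshold_strategy_upto M XL XR \<sigma> \<mu>hi \<mu>lo n c k) k n =
        bandit_stat M XL XR \<sigma> (threshold_strategy M XL XR \<sigma> \<mu>hi \<mu>lo n c) k n"
    by (rule bandit_stat_cong) (simp add: threshold_strategy_upto_eq)
  then show ?thesis
    by (simp add: threshold_strategy_def k)
qed

lemma space_history [simp]: "space (history M XL XR \<theta> n) = space M"
  unfolding history_def by (rule space_measure_of) auto

lemma sets_history:
  "sets (history M XL XR \<theta> n) = sigma_sets (space M)
     (\<Union>i\<in>{1..n}. {reward XL XR \<theta> i -` A \<inter> space M | A. A \<in> sets borel})"
  unfolding history_def by (rule sets_measure_of) auto

lemma subalgebra_history_mono: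
  "m \<le> n \<Longrightarrow> subalgebra (history M XL XR \<theta> n) (history M XL XR \<theta> m)"
  unfolding subalgebra_def sets_history space_history
  by (intro conjI refl sigma_sets_mono' UN_mono) auto

lemma reward_measurable_history:
  assumes "1 \<le> i" "i \<le> n"
  shows "reward XL XR \<theta> i \<in> borel_measurable (history M XL XR \<theta> n)"
proof (rule measurableI)
  fix A :: "real set" assume "A \<in> sets borel"
  then show "reward XL XR \<theta> i -` A \<inter> space (history M XL XR \<theta> n) \<in> sets (history M XL XR \<theta> n)"
    unfolding space_history sets_history using assms
    by (intro sigma_sets.Basic UN_I[where a=i]) auto
qed simp

lemma bandit_stat_measurable_history:
  "bandit_stat M XL XR \<sigma> \<theta> m n \<in> borel_measurable (history M XL XR \<theta> m)"
proof -
  have [measurable]: "reward XL XR \<theta> i \<in> borel_measurable (history M XL XR \<theta> m)"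
    if "i \<in> {1..m}" for i
    using that by (intro reward_measurable_history) auto
  have [measurable]: "real_cond_exp M (history M XL XR \<theta> (i - 1)) (reward XL XR \<theta> i)
      \<in> borel_measurable (history M XL XR \<theta> m)" if "i \<in> {1..m}" for i
    using that
    by (intro measurable_from_subalg[OF subalgebra_history_mono borel_measurable_cond_exp]) auto
  show ?thesis
    unfolding bandit_stat_def[abs_def] by measurable
qed

lemma threshold_strategy_admissible:
  "admissible M XL XR (threshold_strategy M XL XR \<sigma> \<mu>hi \<mu>lo n c)"
  unfolding admissible_def
proof (intro allI impI)
  fix m :: nat assume m: "1 \<le> m"
  let ?\<theta> = "threshold_strategy M XL XR \<sigma> \<mu>hi \<mu>lo n c"
  note stat = bandit_stat_measurable_history[of M XL XR \<sigma> ?\<theta> "m - 1" n]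
  have eq: "?\<theta> m = (\<lambda>\<omega>. if bandit_stat M XL XR \<sigma> ?\<theta> (m - 1) n \<omega>
      \<le> c - (1 - real (m - 1) / real n) * ((\<mu>hi + \<mu>lo) / 2) then 1 else 2)"
    using threshold_strategy_rec[OF m] by (intro ext)
  show "?\<theta> m \<in> measurable (history M XL XR ?\<theta> (m - 1)) (count_space {1, 2})"
    unfolding eq by (intro measurable_If measurable_const borel_measurable_le stat) auto
qed

definition bandit_density :: "real \<Rightarrow> real \<Rightarrow> real \<Rightarrow> real \<Rightarrow> real" where
  "bandit_density \<alpha> \<beta> c y =
     1 / sqrt (2 * pi) *
       exp (- (((y - \<beta>)\<^sup>2 - 2 * \<alpha> * (\<bar>y - c\<bar> - \<bar>c - \<beta>\<bar>) + \<alpha>\<^sup>2) / 2)) -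
     \<alpha> * exp (2 * \<alpha> * \<bar>y - c\<bar>) *
       cdf std_normal_distribution (- \<bar>c - \<beta>\<bar> - \<bar>y - c\<bar> - \<alpha>)"

definition bandit_distribution :: "real \<Rightarrow> real \<Rightarrow> real \<Rightarrow> real measure" where
  "bandit_distribution \<alpha> \<beta> c = density lborel (\<lambda>y. ennreal (bandit_density \<alpha> \<beta> c y))"

lemma expectation_bandit_distribution:
  fixes \<phi> :: "real \<Rightarrow> real"
  assumes "distributed N lborel \<eta> (\<lambda>y. ennreal (bandit_density \<alpha> \<beta> c y))"
    and "\<phi> \<in> borel_measurable borel"
  shows "(\<integral>\<omega>. \<phi> (\<eta> \<omega>) \<partial>N) = (\<integral>y. \<phi> y \<partial>bandit_distribution \<alpha> \<beta> c)"
proof -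
  have "\<eta> \<in> measurable N lborel"
    and eq: "distr N lborel \<eta> = bandit_distribution \<alpha> \<beta> c"
    using assms(1) by (auto simp: distributed_def bandit_distribution_def)
  have "(\<integral>\<omega>. \<phi> (\<eta> \<omega>) \<partial>N) = (\<integral>y. \<phi> y \<partial>distr N lborel \<eta>)"
    using assms(2) \<open>\<eta> \<in> measurable N lborel\<close> by (intro integral_distr[symmetric]) simp_all
  then show ?thesis
    by (simp add: eq)
qed

end

theory Submission
  imports Defs "HOL-Real_Asymp.Real_Asymp"
begin

text \<open>
  Let \<open>\<beta> = (\<mu>\<^sub>L + \<mu>\<^sub>R) / 2\<close> and \<open>\<alpha> = (\<mu>\<^sub>R - \<mu>\<^sub>L) / 2\<close>; with this sign of \<open>\<alpha>\<close> both parts of the theorem are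
  the same statement. The process \<open>S\<^sub>m = T\<^sub>m + (1 - m/n) \<beta> - c\<close> starts at \<open>\<beta> - c\<close>, ends at \<open>T\<^sub>n - c\<close>, and the
  threshold rule is \<open>S\<^sub>m \<le> 0\<close>; its increments have mean \<open>\<alpha> sgn(S\<^sub>m) / n\<close> and variance about \<open>1/n\<close>. Hence
  \<open>\<bar>S\<^sub>m\<bar>\<close> approximates Brownian motion with drift \<open>\<alpha>\<close> reflected at 0, whose transition distribution function
  \<open>U\<^sub>t(x)\<close> at a level \<open>r\<close> is an explicit combination of two values of \<open>\<Phi>\<close>. It solves
  \<open>\<partial>\<^sub>t U = U'' / 2 + \<alpha> U'\<close> with \<open>U'(0) = 0\<close>, so a Lindeberg telescoping along \<open>U\<^sub>t(\<bar>S\<^sub>m\<bar>)\<close> gives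
  \<open>E U\<^sub>\<delta>(\<bar>S\<^sub>n\<bar>) \<longrightarrow> U\<^bsub>1+\<delta>\<^esub>(\<bar>\<beta> - c\<bar>)\<close> for every \<open>\<delta> > 0\<close>. Letting \<open>\<delta> \<longrightarrow> 0\<close> yields convergence in law of
  \<open>\<bar>T\<^sub>n - c\<bar>\<close>, and the symmetrised bandit density is the derivative in \<open>r\<close> of the limit.
\<close>

section \<open>The standard normal distribution function and the heat equation with drift\<close>

text \<open>The obstacle is the origin: the drift of \<open>S\<close> jumps there and
  \<open>\<bar>S\<bar>\<close> has a corner. The condition \<open>U'(0) = 0\<close> removes both at
  once, because the even extension of \<open>U\<close> then has a second-order expansion across 0
  with a cubic error, so steps that start near 0 or cross it are treated like all others. The weight
  of the image term in \<open>refl_cdf\<close> is chosen to make this condition hold. A positive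
  \<open>\<delta>\<close> is kept because the derivatives of \<open>U\<close> blow up as time tends
  to 0, whereas a single constant bounds them at all times from \<open>\<delta>\<close> on. The
  rewards have only second moments, so Taylor errors are measured by the smaller of the cube and the
  square of the increment: the cube makes typical increments negligible, the square is integrable.
  Symmetry of \<open>\<phi>\<close> about \<open>c\<close> is what lets the law of
  \<open>\<bar>T\<^sub>n - c\<bar>\<close> decide the limit; the law of \<open>T\<^sub>n\<close>
  itself is not followed.\<close>

abbreviation Phi :: "real \<Rightarrow> real" where
  "Phi \<equiv> cdf std_normal_distribution"

lemma real_distribution_std_normal: "real_distribution std_normal_distribution"
  using prob_space_normal_density[of 1 0] by (simp add: real_distribution_def real_distribution_axioms_def)

lemma DERIV_std_normal_density:
  "(std_normal_density has_real_derivative - x * std_normal_density x) (at x)"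
  unfolding std_normal_density_def [abs_def]
  by (rule derivative_eq_intros refl | simp)+

text \<open>On a window around \<open>x\<close> the function \<open>Phi\<close> differs from an
  integral of the continuous density by a constant, so the fundamental theorem of calculus applies.
  The base point \<open>a\<close> lies strictly to the left of \<open>x\<close>, which makes the
  identity hold on a full neighbourhood.\<close>

lemma DERIV_Phi: "(Phi has_real_derivative std_normal_density x) (at x)"
proof -
  interpret real_distribution std_normal_distribution
    by (rule real_distribution_std_normal)
  define a where "a = x - 1"
  have cont: "continuous_on {a..x+1} std_normal_density"
    using DERIV_std_normal_density
    by (auto intro!: continuous_at_imp_continuous_on dest: DERIV_isCont)
  have "((\<lambda>u. integral {a..u} std_normal_density) has_real_derivative std_normal_density x)
      (at x within {a..x+1})"
    by (rule integral_has_real_derivative[OF cont]) (auto simp: a_def)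
  then have D: "((\<lambda>u. integral {a..u} std_normal_density) has_real_derivative std_normal_density x) (at x)"
    by (subst (asm) at_within_interior) (auto simp: a_def)
  have eq: "integral {a..u} std_normal_density = Phi u - Phi a" if "a < u" for u
  proof -
    have int: "set_integrable lborel {a<..u} std_normal_density"
      unfolding set_integrable_def by (intro integrable_mult_indicator) auto
    have "Phi u - Phi a = measure std_normal_distribution {a<..u}"
      using that by (rule cdf_diff_eq)
    also have "\<dots> = (LINT y|std_normal_distribution. indicator {a<..u} y)"
      by simp
    also have "\<dots> = (LINT y:{a<..u}|lborel. std_normal_density y)"
      by (subst integral_density) (auto simp: set_lebesgue_integral_def mult.commute)
    also have "\<dots> = integral {a<..u} std_normal_density"
      by (rule set_borel_integral_eq_integral(2)[OF int])
    also have "\<dots> = integral {a..u} std_normal_density"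
      by (rule integral_spike_set; rule negligible_subset[of "{a}"]) auto
    finally show ?thesis by simp
  qed
  have "eventually (\<lambda>u. u \<in> {a<..}) (nhds x)"
    by (rule eventually_nhds_in_open) (auto simp: a_def)
  then have ev: "eventually (\<lambda>u. Phi u = integral {a..u} std_normal_density + Phi a) (nhds x)"
    by eventually_elim (use eq in force)
  have "((\<lambda>u. integral {a..u} std_normal_density + Phi a) has_real_derivative std_normal_density x) (at x)"
    using DERIV_add[OF D DERIV_const] by simp
  then show ?thesis
    using DERIV_cong_ev[OF refl ev refl] by blast
qed

lemma isCont_Phi: "isCont Phi x"
  using DERIV_Phi by (rule DERIV_isCont)

lemma borel_measurable_Phi [measurable]: "Phi \<in> borel_measurable borel"
  by (intro borel_measurable_continuous_onI continuous_at_imp_continuous_on) (simp add: isCont_Phi)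

text \<open>Squaring \<open>y \<le> exp y\<close> at \<open>y = (1 + x\<^sup>2) / 4\<close> produces
  exactly the factor \<open>exp (x\<^sup>2 / 2)\<close> that the density cancels; what remains is
  \<open>16 * exp (1/2)\<close>, and \<open>exp 1 \<le> 3 < 2 * pi\<close> absorbs the root. The
  quartic envelope dominates every polynomial that occurs in the derivatives of the heat
  solution.\<close>

lemma std_normal_poly_bound: "(1 + x\<^sup>2)\<^sup>2 * std_normal_density x \<le> 16"
proof -
  have "(1 + x\<^sup>2) / 4 \<le> exp ((1 + x\<^sup>2) / 4)"
    using exp_ge_add_one_self[of "(1 + x\<^sup>2) / 4"] by linarith
  also have "\<dots> = exp (1/4) * exp (x\<^sup>2/4)" by (simp add: exp_add[symmetric] add_divide_distrib)
  finally have "((1 + x\<^sup>2) / 4)\<^sup>2 \<le> (exp (1/4) * exp (x\<^sup>2/4))\<^sup>2"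
    by (intro power_mono) auto
  then have "((1 + x\<^sup>2) / 4)\<^sup>2 \<le> exp (1/2) * exp (x\<^sup>2/2)"
    by (simp add: power_mult_distrib exp_double[symmetric])
  then have "(1 + x\<^sup>2)\<^sup>2 * exp (- (x\<^sup>2/2)) \<le> 16 * exp (1/2)"
    by (simp add: exp_minus field_simps power2_eq_square)
  moreover have "exp (1/2::real) \<le> sqrt (2 * pi)"
  proof -
    have "exp (1::real) \<le> 2 * pi" using exp_le pi_gt3 by linarith
    then have "sqrt (exp 1) \<le> sqrt (2*pi)" by simp
    moreover have "sqrt (exp 1) = exp (1/2::real)"
      by (rule real_sqrt_unique) (auto simp: exp_double[symmetric])
    ultimately show ?thesis by simp
  qed
  ultimately have "(1 + x\<^sup>2)\<^sup>2 * exp (- (x\<^sup>2/2)) \<le> 16 * sqrt (2 * pi)" by linarith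
  then show ?thesis
    by (simp add: std_normal_density_def field_simps)
qed

lemma std_normal_density_lim: "(std_normal_density \<longlongrightarrow> 0) at_top"
  unfolding std_normal_density_def by real_asymp

lemma Phi_lim_bot: "(Phi \<longlongrightarrow> 0) at_bot"
  using finite_borel_measure.cdf_lim_at_bot real_distribution.finite_borel_measure_M
    real_distribution_std_normal by blast

lemma Phi_lim_top: "(Phi \<longlongrightarrow> 1) at_top"
  using real_distribution.cdf_lim_at_top_prob real_distribution_std_normal by blast

lemma Phi_bounds: "0 \<le> Phi x" "Phi x \<le> 1"
  using real_distribution.cdf_bounded_prob real_distribution_std_normal
  by (auto simp: cdf_def)

lemma DERIV_Phi_minus: "((\<lambda>x. Phi (- x)) has_real_derivative - std_normal_density x) (at x)"
  using DERIV_chain2[OF DERIV_Phi DERIV_minus[OF DERIV_ident], of x]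
  by (simp add: normal_density_def)

text \<open>For \<open>x > 0\<close> the difference of density over \<open>x\<close> and tail has
  derivative \<open>- std_normal_density x / x\<^sup>2\<close>, hence decreases, and it tends to 0
  at infinity, hence is nonnegative. The bound controls the term
  \<open>exp (2 * \<alpha> * r) * Phi _\<close> when \<open>\<alpha> > 0\<close>, both in the sign
  of the bandit density and in its total mass.\<close>

lemma mills_ratio_bound: "x * Phi (- x) \<le> std_normal_density x"
proof -
  consider "x \<le> 0" | "x > 0" by linarith
  then show ?thesis
  proof cases
    case 1
    then have "x * Phi (-x) \<le> 0"
      using Phi_bounds[of "-x"] by (simp add: mult_nonpos_nonneg)
    then show ?thesis
      using normal_density_nonneg[of 0 1 x] by linarith
  next
    case 2
    let ?h = "\<lambda>x. std_normal_density x / x - Phi (- x)"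
    have D: "(?h has_real_derivative - (std_normal_density x / x\<^sup>2)) (at x)" if "x > 0" for x
      using that
      by (auto intro!: derivative_eq_intros DERIV_std_normal_density DERIV_Phi_minus
          simp: field_simps power2_eq_square)
    have "?h y \<le> ?h x" if "x \<le> y" for y
      using that
    proof (rule DERIV_nonpos_imp_nonincreasing)
      fix z assume "x \<le> z" "z \<le> y"
      then show "\<exists>y. (?h has_real_derivative y) (at z) \<and> y \<le> 0"
        using D[of z] 2 by (intro exI[of _ "- (std_normal_density z / z\<^sup>2)"]) auto
    qed
    then have ev: "eventually (\<lambda>y. ?h y \<le> ?h x) at_top"
      by (rule eventually_mono[OF eventually_ge_at_top[of x]])
    have "((\<lambda>y. Phi (- y)) \<longlongrightarrow> 0) at_top"
      by (rule filterlim_compose[OF Phi_lim_bot filterlim_uminus_at_bot_at_top])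
    moreover have "((\<lambda>y. std_normal_density y / y) \<longlongrightarrow> 0) at_top"
      unfolding std_normal_density_def by real_asymp
    ultimately have "(?h \<longlongrightarrow> 0) at_top"
      using tendsto_diff by fastforce
    then have "0 \<le> ?h x"
      using ev by (intro tendsto_upperbound) auto
    then show ?thesis
      using 2 by (simp add: field_simps)
  qed
qed

section \<open>Gaussian transition probabilities with drift and bounds on their derivatives\<close>

definition heat_arg :: "real \<Rightarrow> real \<Rightarrow> real \<Rightarrow> real \<Rightarrow> real" where
  "heat_arg \<alpha> k t x = (k - x - \<alpha> * t) / sqrt t"

lemma DERIV_heat_arg_x:
  "((\<lambda>x. heat_arg \<alpha> k t x) has_real_derivative - (1 / sqrt t)) (at x)"
proof -
  have "((\<lambda>x. (k - x - \<alpha> * t) / sqrt t) has_real_derivative (- 1) / sqrt t) (at x)"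
    by (rule DERIV_cdivide) (auto intro!: derivative_eq_intros)
  then show ?thesis by (simp add: heat_arg_def[abs_def])
qed

text \<open>The derivative is expressed through \<open>heat_arg\<close> itself, so that all later
  derivatives in time remain the normal density times a polynomial in \<open>heat_arg\<close> and
  \<open>1 / sqrt t\<close>.\<close>

lemma DERIV_heat_arg_t:
  assumes "t > 0"
  shows "((\<lambda>t. heat_arg \<alpha> k t x) has_real_derivative
    - (heat_arg \<alpha> k t x + 2 * \<alpha> * sqrt t) / (2 * t)) (at t)"
proof -
  have s: "sqrt t * sqrt t = t" "sqrt t > 0" using assms by auto
  show ?thesis
    unfolding heat_arg_def using assms s
    by (auto intro!: derivative_eq_intros) (simp add: field_simps s)
qed

text \<open>The probability that Brownian motion with drift \<open>\<alpha>\<close>, started at \<open>x\<close>, is at most \<open>k\<close> at time \<open>t\<close>.\<close>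
definition heat_sol :: "real \<Rightarrow> real \<Rightarrow> real \<Rightarrow> real \<Rightarrow> real" where
  "heat_sol \<alpha> k t x = Phi (heat_arg \<alpha> k t x)"

definition heat_sol1 :: "real \<Rightarrow> real \<Rightarrow> real \<Rightarrow> real \<Rightarrow> real" where
  "heat_sol1 \<alpha> k t x = - (std_normal_density (heat_arg \<alpha> k t x) / sqrt t)"

definition heat_sol2 :: "real \<Rightarrow> real \<Rightarrow> real \<Rightarrow> real \<Rightarrow> real" where
  "heat_sol2 \<alpha> k t x = - (heat_arg \<alpha> k t x * std_normal_density (heat_arg \<alpha> k t x) / t)"

definition heat_sol3 :: "real \<Rightarrow> real \<Rightarrow> real \<Rightarrow> real \<Rightarrow> real" where
  "heat_sol3 \<alpha> k t x =
    (1 - (heat_arg \<alpha> k t x)\<^sup>2) * std_normal_density (heat_arg \<alpha> k t x) / (t * sqrt t)"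

lemma DERIV_heat_sol:
  "t > 0 \<Longrightarrow> (heat_sol \<alpha> k t has_real_derivative heat_sol1 \<alpha> k t x) (at x)"
  unfolding heat_sol_def [abs_def] heat_sol1_def
  by (rule DERIV_cong[OF DERIV_chain2[OF DERIV_Phi DERIV_heat_arg_x]]) simp

lemma DERIV_heat_sol1:
  "t > 0 \<Longrightarrow> (heat_sol1 \<alpha> k t has_real_derivative heat_sol2 \<alpha> k t x) (at x)"
  unfolding heat_sol1_def [abs_def] heat_sol2_def
  by (auto intro!: derivative_eq_intros DERIV_heat_arg_x DERIV_chain2[OF DERIV_std_normal_density])

lemma DERIV_heat_sol2:
  "t > 0 \<Longrightarrow> (heat_sol2 \<alpha> k t has_real_derivative heat_sol3 \<alpha> k t x) (at x)"
  unfolding heat_sol2_def [abs_def] heat_sol3_def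
  by (auto intro!: derivative_eq_intros DERIV_heat_arg_x DERIV_chain2[OF DERIV_std_normal_density]
      simp: field_simps power2_eq_square)

text \<open>The backward Kolmogorov equation.\<close>
lemma DERIV_heat_sol_t:
  assumes "t > 0"
  shows "((\<lambda>t. heat_sol \<alpha> k t x) has_real_derivative
     heat_sol2 \<alpha> k t x / 2 + \<alpha> * heat_sol1 \<alpha> k t x) (at t)"
proof -
  have s: "sqrt t * sqrt t = t" "sqrt t > 0" using assms by auto
  show ?thesis
    unfolding heat_sol_def heat_sol1_def heat_sol2_def
    by (rule DERIV_cong[OF DERIV_chain2[OF DERIV_Phi DERIV_heat_arg_t[OF assms]]])
       (use s in \<open>simp add: field_simps\<close>)
qed

text \<open>The second derivative in time, since by the Kolmogorov equation the function
  differentiated here is the first one. It bounds the error of one time step; the shape density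
  times polynomial in \<open>z\<close> and \<open>s\<close> is the one that
  \<open>heat_sol_bounds\<close> estimates term by term.\<close>

lemma DERIV_heat_sol_tt:
  fixes \<alpha> k t x :: real
  defines "z \<equiv> heat_arg \<alpha> k t x" and "s \<equiv> 1 / sqrt t"
  assumes "t > 0"
  shows "((\<lambda>t. heat_sol2 \<alpha> k t x / 2 + \<alpha> * heat_sol1 \<alpha> k t x) has_real_derivative
     std_normal_density z * ((1 - z\<^sup>2) * z * s ^ 4 / 4 + (1 - z\<^sup>2) * \<alpha> * s ^ 3 / 2 + z * s ^ 4 / 2
       - \<alpha> * z\<^sup>2 * s ^ 3 / 2 - \<alpha>\<^sup>2 * z * s\<^sup>2 + \<alpha> * s ^ 3 / 2)) (at t)"
proof -
  \<comment> \<open>With \<open>t = r\<^sup>2\<close> all expressions become rational in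
    \<open>r\<close> and \<open>z\<close>, which reduces the final comparison to field
    arithmetic.\<close>
  define r where "r = sqrt t"
  have r: "r > 0" "t = r\<^sup>2" using assms by (auto simp: r_def)
  let ?z' = "- (z + 2 * \<alpha> * r) / (2 * r\<^sup>2)"
  have Dz: "((\<lambda>t. heat_arg \<alpha> k t x) has_real_derivative ?z') (at t)"
    using DERIV_heat_arg_t[OF \<open>t > 0\<close>, of \<alpha> k x] unfolding z_def[symmetric] r_def[symmetric] r(2)[symmetric] .
  have Dg: "((\<lambda>t. std_normal_density (heat_arg \<alpha> k t x)) has_real_derivative
      (- z * std_normal_density z) * ?z') (at t)"
    using DERIV_chain2[OF DERIV_std_normal_density Dz] unfolding z_def .
  have D2: "((\<lambda>t. heat_sol2 \<alpha> k t x) has_real_derivative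
      - (((?z' * std_normal_density z + (- z * std_normal_density z) * ?z' * z) * t
        - z * std_normal_density z * 1) / (t * t))) (at t)"
    unfolding heat_sol2_def using assms
    by (intro DERIV_minus DERIV_cong[OF DERIV_divide[OF DERIV_mult[OF Dz Dg] DERIV_ident]])
      (auto simp: z_def)
  have Ds: "(sqrt has_real_derivative 1 / (2 * r)) (at t)"
    using DERIV_real_sqrt[OF \<open>t > 0\<close>] by (simp add: r_def field_simps)
  have D1: "((\<lambda>t. heat_sol1 \<alpha> k t x) has_real_derivative
      - (((- z * std_normal_density z) * ?z' * r - std_normal_density z * (1 / (2 * r))) / (r * r))) (at t)"
    unfolding heat_sol1_def using assms
    by (intro DERIV_minus DERIV_cong[OF DERIV_divide[OF Dg Ds]]) (auto simp: z_def r_def)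
  show ?thesis
    by (rule DERIV_cong[OF DERIV_add[OF DERIV_cdivide[OF D2] DERIV_cmult[OF D1]]])
       (use r in \<open>simp add: s_def r_def[symmetric] field_simps power2_eq_square power3_eq_cube power4_eq_xxxx\<close>)
qed

text \<open>Each derivative is the normal density at \<open>z\<close> times a polynomial of degree
  at most 3 in \<open>z\<close> and at most 4 in \<open>1 / sqrt t\<close>. The Gaussian beats the
  first factor, and \<open>t \<ge> d\<close> bounds the second. The point is uniformity:
  \<open>C\<close> depends on \<open>\<alpha>\<close> and \<open>d\<close> only, so it serves every
  step of the walk.\<close>

lemma heat_sol_bounds:
  fixes \<alpha> d :: real
  assumes "d > 0"
  obtains C where
    "\<And>k t x. d \<le> t \<Longrightarrow> \<bar>heat_sol1 \<alpha> k t x\<bar> \<le> C"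
    "\<And>k t x. d \<le> t \<Longrightarrow> \<bar>heat_sol2 \<alpha> k t x\<bar> \<le> C"
    "\<And>k t x. d \<le> t \<Longrightarrow> \<bar>heat_sol3 \<alpha> k t x\<bar> \<le> C"
    "\<And>k t x. d \<le> t \<Longrightarrow> \<exists>D. \<bar>D\<bar> \<le> C \<and>
       ((\<lambda>t. heat_sol2 \<alpha> k t x / 2 + \<alpha> * heat_sol1 \<alpha> k t x) has_real_derivative D) (at t)"
proof -
  \<comment> \<open>The summand 1 ensures \<open>S \<ge> 1\<close>, so that \<open>S ^ 4\<close>
    dominates all lower powers of \<open>1 / sqrt t\<close> as well. In \<open>C\<close> the last
    factor exceeds the sum of the coefficients of the second time derivative, and 16 is the constant
    of \<open>std_normal_poly_bound\<close>.\<close>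
  define S where "S = 1 + 1 / sqrt d"
  define C where "C = 16 * (S ^ 4 * (3 + 3 * \<bar>\<alpha>\<bar> + \<alpha>\<^sup>2))"
  have key: "std_normal_density z * \<bar>p\<bar> \<le> 16 * B" if "\<bar>p\<bar> \<le> (1 + z\<^sup>2)\<^sup>2 * B" for z p B
  proof -
    have "(1 + z\<^sup>2)\<^sup>2 * B \<ge> 0" using that by linarith
    then have B: "B \<ge> 0"
      by (metis add_pos_nonneg mult_less_0_iff not_less power2_less_0 zero_le_power2 zero_less_one zero_less_power)
    have "std_normal_density z * \<bar>p\<bar> \<le> std_normal_density z * ((1 + z\<^sup>2)\<^sup>2 * B)"
      using that by (intro mult_left_mono) auto
    also have "\<dots> = ((1 + z\<^sup>2)\<^sup>2 * std_normal_density z) * B" by (simp only: mult_ac)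
    also have "\<dots> \<le> 16 * B"
      by (intro mult_right_mono std_normal_poly_bound B)
    finally show ?thesis .
  qed
  have z: "1 \<le> (1 + z\<^sup>2)\<^sup>2" "\<bar>z\<bar> \<le> (1 + z\<^sup>2)\<^sup>2" "z\<^sup>2 \<le> (1 + z\<^sup>2)\<^sup>2" "\<bar>1 - z\<^sup>2\<bar> \<le> (1 + z\<^sup>2)\<^sup>2"
    "\<bar>(1 - z\<^sup>2) * z\<bar> \<le> (1 + z\<^sup>2)\<^sup>2" for z :: real
  proof -
    have a: "\<bar>z\<bar> \<le> 1 + z\<^sup>2"
      using sum_squares_ge_zero[of "\<bar>z\<bar> - 1" 0] zero_le_power2[of "\<bar>z\<bar> - 1"] by (simp add: power2_eq_square algebra_simps)
    have b: "\<bar>1 - z\<^sup>2\<bar> \<le> 1 + z\<^sup>2" "1 \<le> 1 + z\<^sup>2" "z\<^sup>2 \<le> 1 + z\<^sup>2" by (auto simp: abs_if)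
    then have c: "1 + z\<^sup>2 \<le> (1 + z\<^sup>2)\<^sup>2" by (simp add: power2_eq_square mult_le_cancel_left1)
    show "1 \<le> (1 + z\<^sup>2)\<^sup>2" "\<bar>z\<bar> \<le> (1 + z\<^sup>2)\<^sup>2" "z\<^sup>2 \<le> (1 + z\<^sup>2)\<^sup>2" "\<bar>1 - z\<^sup>2\<bar> \<le> (1 + z\<^sup>2)\<^sup>2"
      using a b c by linarith+
    show "\<bar>(1 - z\<^sup>2) * z\<bar> \<le> (1 + z\<^sup>2)\<^sup>2"
      unfolding abs_mult power2_eq_square[of "1 + z\<^sup>2"] using a b by (intro mult_mono) auto
  qed
  have S: "0 \<le> 1 / sqrt t" "1 / sqrt t \<le> S" if "d \<le> t" for t
  proof -
    have "1 / sqrt t \<le> 1 / sqrt d" using that assms by (intro divide_left_mono) auto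
    then show "0 \<le> 1 / sqrt t" "1 / sqrt t \<le> S" using that assms by (auto simp: S_def)
  qed
  have S1: "1 \<le> S" using assms by (simp add: S_def)
  have pw: "(1 / sqrt t) ^ j \<le> S ^ 4" if "d \<le> t" "j \<le> 4" for t j
  proof -
    have "(1 / sqrt t) ^ j \<le> S ^ j" using S[OF that(1)] by (intro power_mono) auto
    also have "\<dots> \<le> S ^ 4" using S1 that by (intro power_increasing) auto
    finally show ?thesis .
  qed
  have bnd: "\<bar>p * (1 / sqrt t) ^ j\<bar> \<le> w * S ^ 4" if "d \<le> t" "j \<le> 4" "\<bar>p\<bar> \<le> w" for t j p w
    unfolding abs_mult using that S[OF that(1)] pw[OF that(1,2)] by (intro mult_mono) auto
  have C16: "16 * S ^ 4 \<le> C"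
    using S1 by (auto simp: C_def mult_le_cancel_left1)
  show thesis
  proof
    fix k t x assume t: "d \<le> t"
    with assms have t0: "t > 0" by simp
    define z where "z = heat_arg \<alpha> k t x"
    have "heat_sol1 \<alpha> k t x = - (std_normal_density z * (1 * (1 / sqrt t) ^ 1))"
      using t0 by (simp add: heat_sol1_def z_def)
    then have "\<bar>heat_sol1 \<alpha> k t x\<bar> = std_normal_density z * \<bar>1 * (1 / sqrt t) ^ 1\<bar>"
      by (simp add: abs_mult)
    also have "\<dots> \<le> 16 * S ^ 4"
      by (intro key bnd t) (use z in auto)
    finally show "\<bar>heat_sol1 \<alpha> k t x\<bar> \<le> C" using C16 by linarith
    have "heat_sol2 \<alpha> k t x = - (std_normal_density z * (z * (1 / sqrt t) ^ 2))"
      using t0 by (simp add: heat_sol2_def z_def power_divide)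
    then have "\<bar>heat_sol2 \<alpha> k t x\<bar> = std_normal_density z * \<bar>z * (1 / sqrt t) ^ 2\<bar>"
      by (simp add: abs_mult)
    also have "\<dots> \<le> 16 * S ^ 4"
      by (intro key bnd t z) auto
    finally show "\<bar>heat_sol2 \<alpha> k t x\<bar> \<le> C" using C16 by linarith
    have "heat_sol3 \<alpha> k t x = std_normal_density z * ((1 - z\<^sup>2) * (1 / sqrt t) ^ 3)"
      using t0 by (simp add: heat_sol3_def z_def power_divide power3_eq_cube)
    then have "\<bar>heat_sol3 \<alpha> k t x\<bar> = std_normal_density z * \<bar>(1 - z\<^sup>2) * (1 / sqrt t) ^ 3\<bar>"
      by (simp add: abs_mult)
    also have "\<dots> \<le> 16 * S ^ 4"
      by (intro key bnd t z) auto
    finally show "\<bar>heat_sol3 \<alpha> k t x\<bar> \<le> C" using C16 by linarith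
    define s where "s = 1 / sqrt t"
    let ?p = "(1 - z\<^sup>2) * z * s ^ 4 / 4 + (1 - z\<^sup>2) * \<alpha> * s ^ 3 / 2 + z * s ^ 4 / 2
       - \<alpha> * z\<^sup>2 * s ^ 3 / 2 - \<alpha>\<^sup>2 * z * s\<^sup>2 + \<alpha> * s ^ 3 / 2"
    let ?w = "(1 + z\<^sup>2)\<^sup>2"
    have "\<bar>((1 - z\<^sup>2) * z) * s ^ 4\<bar> \<le> ?w * S ^ 4"  "\<bar>(1 - z\<^sup>2) * s ^ 3\<bar> \<le> ?w * S ^ 4"
      "\<bar>z * s ^ 4\<bar> \<le> ?w * S ^ 4" "\<bar>z\<^sup>2 * s ^ 3\<bar> \<le> ?w * S ^ 4"
      "\<bar>z * s\<^sup>2\<bar> \<le> ?w * S ^ 4" "\<bar>1 * s ^ 3\<bar> \<le> ?w * S ^ 4"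
      unfolding s_def by (intro bnd t z; simp add: z)+
    note b = this this(2,4,6)[THEN mult_left_mono[OF _ abs_ge_zero[of \<alpha>]]] this(5)[THEN mult_left_mono[OF _ abs_ge_zero[of "\<alpha>\<^sup>2"]]]
    have e: "?p = (((1 - z\<^sup>2) * z) * s ^ 4) / 4 + \<alpha> * ((1 - z\<^sup>2) * s ^ 3) / 2 + (z * s ^ 4) / 2
       - \<alpha> * (z\<^sup>2 * s ^ 3) / 2 - \<alpha>\<^sup>2 * (z * s\<^sup>2) + \<alpha> * (1 * s ^ 3) / 2" by (simp only: mult_ac mult_1)
    have tri: "\<bar>a1 / 4 + a2 / 2 + a3 / 2 - a4 / 2 - a5 + a6 / 2\<bar> \<le>
      \<bar>a1\<bar> / 4 + \<bar>a2\<bar> / 2 + \<bar>a3\<bar> / 2 + \<bar>a4\<bar> / 2 + \<bar>a5\<bar> + \<bar>a6\<bar> / 2" for a1 a2 a3 a4 a5 a6 :: real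
      by linarith
    have "\<bar>?p\<bar> \<le> ?w * S ^ 4 / 4 + \<bar>\<alpha>\<bar> * (?w * S ^ 4) / 2 + ?w * S ^ 4 / 2 + \<bar>\<alpha>\<bar> * (?w * S ^ 4) / 2
       + \<alpha>\<^sup>2 * (?w * S ^ 4) + \<bar>\<alpha>\<bar> * (?w * S ^ 4) / 2"
      unfolding e
    proof (rule order_trans[OF tri])
      show "\<bar>((1 - z\<^sup>2) * z) * s ^ 4\<bar> / 4 + \<bar>\<alpha> * ((1 - z\<^sup>2) * s ^ 3)\<bar> / 2 + \<bar>z * s ^ 4\<bar> / 2
          + \<bar>\<alpha> * (z\<^sup>2 * s ^ 3)\<bar> / 2 + \<bar>\<alpha>\<^sup>2 * (z * s\<^sup>2)\<bar> + \<bar>\<alpha> * (1 * s ^ 3)\<bar> / 2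
        \<le> ?w * S ^ 4 / 4 + \<bar>\<alpha>\<bar> * (?w * S ^ 4) / 2 + ?w * S ^ 4 / 2 + \<bar>\<alpha>\<bar> * (?w * S ^ 4) / 2
          + \<alpha>\<^sup>2 * (?w * S ^ 4) + \<bar>\<alpha>\<bar> * (?w * S ^ 4) / 2"
        unfolding abs_mult[of \<alpha>] abs_mult[of "\<alpha>\<^sup>2"] abs_power2
        by (intro add_mono divide_right_mono b[unfolded abs_power2]) simp_all
    qed
    also have "\<dots> = ?w * (S ^ 4 * (3/4 + 3 / 2 * \<bar>\<alpha>\<bar> + \<alpha>\<^sup>2))"
      by (simp add: algebra_simps)
    also have "\<dots> \<le> ?w * (S ^ 4 * (3 + 3 * \<bar>\<alpha>\<bar> + \<alpha>\<^sup>2))"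
      using S1 by (intro mult_left_mono) auto
    finally have "std_normal_density z * \<bar>?p\<bar> \<le> C"
      unfolding C_def by (rule key)
    then show "\<exists>D. \<bar>D\<bar> \<le> C \<and>
       ((\<lambda>t. heat_sol2 \<alpha> k t x / 2 + \<alpha> * heat_sol1 \<alpha> k t x) has_real_derivative D) (at t)"
      using DERIV_heat_sol_tt[OF t0, of \<alpha> k x] unfolding z_def[symmetric] s_def[symmetric]
      by (intro exI[of _ "std_normal_density z * ?p"]) (simp add: abs_mult)
  qed
qed

section \<open>Taylor remainders and reflection at the origin\<close>

lemma taylor_remainder_cubic:
  fixes f f1 f2 f3 :: "real \<Rightarrow> real"
  assumes D: "\<And>x. (f has_real_derivative f1 x) (at x)" "\<And>x. (f1 has_real_derivative f2 x) (at x)"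
    "\<And>x. (f2 has_real_derivative f3 x) (at x)" and K: "\<And>x. \<bar>f3 x\<bar> \<le> K"
  shows "\<bar>f y - f x - f1 x * (y - x) - f2 x / 2 * (y - x)\<^sup>2\<bar> \<le> K * \<bar>y - x\<bar> ^ 3"
proof (cases "y = x")
  case False
  let ?d = "\<lambda>m::nat. if m = 0 then f else if m = 1 then f1 else if m = 2 then f2 else f3"
  have "\<exists>t. (if y < x then y < t \<and> t < x else x < t \<and> t < y) \<and>
    f y = (\<Sum>m<3. (?d m x / fact m) * (y - x)^m) + (?d 3 t / fact 3) * (y - x)^3"
    using False D by (intro Taylor[of 3 ?d f "min x y" "max x y"]) (auto simp: less_Suc_eq numeral_3_eq_3)
  then obtain t where "f y = (\<Sum>m<3. (?d m x / fact m) * (y - x)^m) + (?d 3 t / fact 3) * (y - x)^3"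
    by blast
  then have "f y - f x - f1 x * (y - x) - f2 x / 2 * (y - x)\<^sup>2 = f3 t / 6 * (y - x) ^ 3"
    by (simp add: numeral_3_eq_3 fact_numeral eval_nat_numeral)
  also have "\<bar>\<dots>\<bar> \<le> K * \<bar>y - x\<bar> ^ 3"
    unfolding abs_mult power_abs using K[of t] by (intro mult_right_mono) auto
  finally show ?thesis .
qed simp

text \<open>Stated on an interval, unlike the cubic version, because in the time variable the
  derivatives are controlled only from \<open>d\<close> on.\<close>

lemma taylor_remainder_quadratic:
  fixes f f1 f2 :: "real \<Rightarrow> real"
  assumes D: "\<And>x. x \<in> {a..b} \<Longrightarrow> (f has_real_derivative f1 x) (at x)"
    "\<And>x. x \<in> {a..b} \<Longrightarrow> (f1 has_real_derivative f2 x) (at x)"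
    and K: "\<And>x. x \<in> {a..b} \<Longrightarrow> \<bar>f2 x\<bar> \<le> K" and "x \<in> {a..b}" "y \<in> {a..b}"
  shows "\<bar>f y - f x - f1 x * (y - x)\<bar> \<le> K * (y - x)\<^sup>2"
proof (cases "y = x")
  case False
  let ?d = "\<lambda>m::nat. if m = 0 then f else if m = 1 then f1 else f2"
  have "\<exists>t. (if y < x then y < t \<and> t < x else x < t \<and> t < y) \<and>
    f y = (\<Sum>m<2. (?d m x / fact m) * (y - x)^m) + (?d 2 t / fact 2) * (y - x)^2"
    using False assms by (intro Taylor[of 2 ?d f a b]) (auto simp: less_Suc_eq numeral_2_eq_2)
  then obtain t where t: "f y = (\<Sum>m<2. (?d m x / fact m) * (y - x)^m) + (?d 2 t / fact 2) * (y - x)^2"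
    and "(if y < x then y < t \<and> t < x else x < t \<and> t < y)"
    by blast
  then have "t \<in> {a..b}" using assms by (auto split: if_splits)
  from t have "f y - f x - f1 x * (y - x) = f2 t / 2 * (y - x) ^ 2"
    by (simp add: eval_nat_numeral)
  also have "\<bar>\<dots>\<bar> \<le> K * (y - x)\<^sup>2"
    unfolding abs_mult abs_power2 using K[OF \<open>t \<in> {a..b}\<close>] by (intro mult_right_mono) auto
  finally show ?thesis .
qed simp


text \<open>Since the derivative vanishes at 0, reflecting the increment at 0 costs only a cubic error.\<close>
lemma taylor_even_extension:
  fixes f f1 f2 f3 :: "real \<Rightarrow> real"
  assumes D: "\<And>x. (f has_real_derivative f1 x) (at x)" "\<And>x. (f1 has_real_derivative f2 x) (at x)"
    "\<And>x. (f2 has_real_derivative f3 x) (at x)"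
    and K: "\<And>x. \<bar>f2 x\<bar> \<le> K" "\<And>x. \<bar>f3 x\<bar> \<le> K" and 0: "f1 0 = 0"
  shows "\<bar>f (\<bar>y\<bar>) - f (\<bar>x\<bar>) - (if x \<le> 0 then - f1 (\<bar>x\<bar>) else f1 (\<bar>x\<bar>)) * (y - x) - f2 (\<bar>x\<bar>) / 2 * (y - x)\<^sup>2\<bar>
    \<le> 6 * K * min (\<bar>y - x\<bar> ^ 3) ((y - x)\<^sup>2)"
proof -
  have K0: "K \<ge> 0" using K(1)[of 0] by linarith
  have T3: "\<bar>f y - f x - f1 x * (y - x) - f2 x / 2 * (y - x)\<^sup>2\<bar> \<le> K * \<bar>y - x\<bar> ^ 3" for x y
    by (rule taylor_remainder_cubic[of f f1 f2 f3, OF D K(2)])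
  have T2: "\<bar>f y - f x - f1 x * (y - x)\<bar> \<le> K * (y - x)\<^sup>2" for x y
    by (rule taylor_remainder_quadratic[of "min x y" "max x y" f f1 f2]) (use D K in auto)
  have T2': "\<bar>f1 y - f1 x - f2 x * (y - x)\<bar> \<le> K * (y - x)\<^sup>2" for x y
    by (rule taylor_remainder_quadratic[of "min x y" "max x y" f1 f2 f3]) (use D K in auto)
  \<comment> \<open>Mean value theorem from 0, where \<open>f1\<close> vanishes.\<close>
  have T1: "\<bar>f1 x\<bar> \<le> K * \<bar>x\<bar>" for x
  proof -
    have "\<exists>t. f1 x - f1 0 = (x - 0) * f2 t" if "x \<noteq> 0"
    proof (cases "x > 0")
      case True
      then show ?thesis using MVT2[of 0 x f1 f2] D(2) by auto
    next
      case False
      with that have "x < 0" by simp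
      then obtain z where "f1 0 - f1 x = (0 - x) * f2 z" using MVT2[of x 0 f1 f2] D(2) by auto
      then have "f1 x - f1 0 = (x - 0) * f2 z" by simp
      then show ?thesis by blast
    qed
    then show ?thesis using 0 K(1)
      by (cases "x = 0") (auto simp: abs_mult mult.commute intro!: mult_right_mono)
  qed
  have main: "\<bar>f (\<bar>y\<bar>) - f x - f1 x * (y - x) - f2 x / 2 * (y - x)\<^sup>2\<bar>
    \<le> 6 * K * min (\<bar>y - x\<bar> ^ 3) ((y - x)\<^sup>2)" if "x \<ge> 0" for x y
  proof -
    define E where "E = \<bar>f (\<bar>y\<bar>) - f x - f1 x * (y - x) - f2 x / 2 * (y - x)\<^sup>2\<bar>"
    have f2b: "\<bar>f2 x / 2 * (y - x)\<^sup>2\<bar> \<le> K / 2 * (y - x)\<^sup>2" for y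
      unfolding abs_mult abs_power2 using K(1)[of x] by (intro mult_right_mono) auto
    \<comment> \<open>The 6 comes from the quadratic bound when \<open>y < 0\<close>: 2 for the
      expansion at the reflected point and 4 for the correction term. The cubic bound needs only
      3.\<close>
    have "E \<le> 6 * (K * \<bar>y - x\<bar> ^ 3) \<and> E \<le> 6 * (K * (y - x)\<^sup>2)"
    proof (cases "y \<ge> 0")
      case True
      have nn: "K * \<bar>y - x\<bar> ^ 3 \<ge> 0" "K * (y - x)\<^sup>2 \<ge> 0" using K0 by auto
      have "E \<le> K * \<bar>y - x\<bar> ^ 3" using T3[of y x] True by (simp add: E_def)
      moreover have "E \<le> K * (y - x)\<^sup>2 + K / 2 * (y - x)\<^sup>2"
        using T2[of y x] f2b[of y] True unfolding E_def abs_of_nonneg[OF True] by linarith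
      ultimately show ?thesis using nn by (auto intro: order_trans)
    next
      case False
      define y' where "y' = - y"
      have y': "y' > 0" using False by (simp add: y'_def)
      have ab: "\<bar>y' - x\<bar> \<le> \<bar>y - x\<bar>" using y' that by (auto simp: y'_def abs_if)
      have "\<bar>y' - x\<bar> ^ 3 \<le> \<bar>y - x\<bar> ^ 3" using ab by (intro power_mono) auto
      then have "K * \<bar>y' - x\<bar> ^ 3 \<le> K * \<bar>y - x\<bar> ^ 3" using K0 by (rule mult_left_mono)
      with T3[of y' x] have A3: "\<bar>f y' - f x - f1 x * (y' - x) - f2 x / 2 * (y' - x)\<^sup>2\<bar> \<le> K * \<bar>y - x\<bar> ^ 3"
        by linarith
      have "(y' - x)\<^sup>2 \<le> (y - x)\<^sup>2" using ab by (simp add: abs_le_square_iff)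
      then have "K * (y' - x)\<^sup>2 \<le> K * (y - x)\<^sup>2" "K / 2 * (y' - x)\<^sup>2 \<le> K / 2 * (y - x)\<^sup>2"
        using K0 by (auto intro: mult_left_mono)
      with T2[of y' x] f2b[of y']
      have A2: "\<bar>f y' - f x - f1 x * (y' - x) - f2 x / 2 * (y' - x)\<^sup>2\<bar> \<le> 2 * (K * (y - x)\<^sup>2)"
        using f2b[of y] by linarith
      \<comment> \<open>Expanding at \<open>y' = - y\<close> instead of \<open>y\<close> changes the
        linear and quadratic terms by \<open>2 * y' * (f1 x - x * f2 x)\<close>. The bracket is a
        Taylor remainder of \<open>f1\<close> between \<open>x\<close> and 0, hence of order
        \<open>x\<^sup>2\<close> because \<open>f1 0 = 0\<close>; and
        \<open>\<bar>y - x\<bar> = y' + x\<close> dominates both \<open>x\<close> and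
        \<open>y'\<close>.\<close>
      have eq: "f (\<bar>y\<bar>) - f x - f1 x * (y - x) - f2 x / 2 * (y - x)\<^sup>2 =
         (f y' - f x - f1 x * (y' - x) - f2 x / 2 * (y' - x)\<^sup>2) + 2 * y' * (f1 x - x * f2 x)"
        using y' by (simp add: y'_def power2_eq_square algebra_simps)
      have bx: "\<bar>f1 x - x * f2 x\<bar> \<le> K * x\<^sup>2"
        using T2'[of 0 x] 0 by (simp add: abs_minus_commute mult.commute algebra_simps)
      have bx2: "\<bar>f1 x - x * f2 x\<bar> \<le> 2 * (K * x)"
      proof -
        have "\<bar>x * f2 x\<bar> \<le> x * K" unfolding abs_mult using that K(1)[of x] by (intro mult_mono) auto
        then show ?thesis using T1[of x] that by (simp add: mult.commute)
      qed
      have "\<bar>2 * y' * (f1 x - x * f2 x)\<bar> \<le> 2 * y' * (K * x\<^sup>2)"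
        unfolding abs_mult using bx y' by (intro mult_mono) auto
      also have "\<dots> = 2 * (K * (y' * x\<^sup>2))" by simp
      also have "y' * x\<^sup>2 \<le> \<bar>y - x\<bar> ^ 3"
      proof -
        have "y' * (x * x) \<le> \<bar>y - x\<bar> * (\<bar>y - x\<bar> * \<bar>y - x\<bar>)"
          using y' that by (intro mult_mono) (auto simp: y'_def)
        then show ?thesis by (simp add: power2_eq_square power3_eq_cube mult.assoc)
      qed
      finally have B3: "\<bar>2 * y' * (f1 x - x * f2 x)\<bar> \<le> 2 * (K * \<bar>y - x\<bar> ^ 3)"
        using K0 by (simp add: mult_left_mono)
      have "\<bar>2 * y' * (f1 x - x * f2 x)\<bar> \<le> 2 * y' * (2 * (K * x))"
        unfolding abs_mult using bx2 y' by (intro mult_mono) auto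
      also have "\<dots> = 4 * (K * (y' * x))" by simp
      also have "y' * x \<le> (y - x)\<^sup>2"
      proof -
        have "y' * x \<le> \<bar>y - x\<bar> * \<bar>y - x\<bar>"
          using y' that by (intro mult_mono) (auto simp: y'_def)
        then show ?thesis by (simp add: power2_eq_square)
      qed
      finally have B2: "\<bar>2 * y' * (f1 x - x * f2 x)\<bar> \<le> 4 * (K * (y - x)\<^sup>2)"
        using K0 by (simp add: mult_left_mono)
      have nn: "K * \<bar>y - x\<bar> ^ 3 \<ge> 0" using K0 by auto
      show ?thesis
        unfolding E_def eq using A2 A3 B2 B3 nn by linarith
    qed
    then show ?thesis unfolding E_def by (simp add: min_def)
  qed
  show ?thesis
  proof (cases "x \<le> 0")
    case True
    then show ?thesis using main[of "- x" "- y"] by (simp add: power2_commute abs_minus_commute algebra_simps)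
  next
    case False
    then show ?thesis using main[of x y] by simp
  qed
qed

text \<open>
  By the method of images: the probability that Brownian motion on the half-line with drift \<open>\<alpha>\<close>,
  reflected at 0 and started at \<open>x \<ge> 0\<close>, is at most \<open>r\<close> at time \<open>t\<close>.
\<close>
definition refl_cdf :: "real \<Rightarrow> real \<Rightarrow> real \<Rightarrow> real \<Rightarrow> real" where
  "refl_cdf \<alpha> r t x = heat_sol \<alpha> r t x - exp (2 * \<alpha> * r) * heat_sol \<alpha> (- r) t x"

text \<open>All that the telescoping uses about \<open>refl_cdf\<close>: \<open>U1\<close> and
  \<open>U2\<close> are its first two derivatives in \<open>x\<close>, the first estimate is the
  expansion in space across the origin, and the second is the expansion in time with the time
  derivative already replaced by the generator. \<open>K\<close> does not depend on
  \<open>t\<close>, \<open>x\<close> or the increment.\<close>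

lemma refl_cdf_regularity:
  assumes "d > 0"
  obtains U1 U2 K where
    "\<And>t x y. d \<le> t \<Longrightarrow> \<bar>refl_cdf \<alpha> r t (\<bar>y\<bar>) - refl_cdf \<alpha> r t (\<bar>x\<bar>)
        - (if x \<le> 0 then - U1 t (\<bar>x\<bar>) else U1 t (\<bar>x\<bar>)) * (y - x) - U2 t (\<bar>x\<bar>) / 2 * (y - x)\<^sup>2\<bar>
      \<le> K * min (\<bar>y - x\<bar> ^ 3) ((y - x)\<^sup>2)"
    "\<And>t h x. d \<le> t \<Longrightarrow> h \<ge> 0 \<Longrightarrow>
      \<bar>refl_cdf \<alpha> r (t + h) x - refl_cdf \<alpha> r t x - (U2 t x / 2 + \<alpha> * U1 t x) * h\<bar> \<le> K * h\<^sup>2"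
    "\<And>t x. d \<le> t \<Longrightarrow> \<bar>U2 t x\<bar> \<le> K"
    "\<And>t. d \<le> t \<Longrightarrow> U1 t \<in> borel_measurable borel"
    "\<And>t. d \<le> t \<Longrightarrow> U2 t \<in> borel_measurable borel"
    "\<And>t x. d \<le> t \<Longrightarrow> \<bar>U1 t x\<bar> \<le> K"
proof -
  obtain C where C:
    "\<And>k t x. d \<le> t \<Longrightarrow> \<bar>heat_sol1 \<alpha> k t x\<bar> \<le> C"
    "\<And>k t x. d \<le> t \<Longrightarrow> \<bar>heat_sol2 \<alpha> k t x\<bar> \<le> C"
    "\<And>k t x. d \<le> t \<Longrightarrow> \<bar>heat_sol3 \<alpha> k t x\<bar> \<le> C"
    "\<And>k t x. d \<le> t \<Longrightarrow> \<exists>D. \<bar>D\<bar> \<le> C \<and>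
       ((\<lambda>t. heat_sol2 \<alpha> k t x / 2 + \<alpha> * heat_sol1 \<alpha> k t x) has_real_derivative D) (at t)"
    using heat_sol_bounds[OF assms, of \<alpha>] by blast
  define e where "e = exp (2 * \<alpha> * r)"
  define U1 where "U1 t x = heat_sol1 \<alpha> r t x - e * heat_sol1 \<alpha> (- r) t x" for t x
  define U2 where "U2 t x = heat_sol2 \<alpha> r t x - e * heat_sol2 \<alpha> (- r) t x" for t x
  define U3 where "U3 t x = heat_sol3 \<alpha> r t x - e * heat_sol3 \<alpha> (- r) t x" for t x
  define C' where "C' = C + e * C"
  have e: "e > 0" by (simp add: e_def)
  have comb: "\<bar>a - e * b\<bar> \<le> C'" if "\<bar>a\<bar> \<le> C" "\<bar>b\<bar> \<le> C" for a b
  proof -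
    have "\<bar>e * b\<bar> \<le> e * C" unfolding abs_mult using e that by (intro mult_mono) auto
    then show ?thesis using that by (simp add: C'_def)
  qed
  have D: "(refl_cdf \<alpha> r t has_real_derivative U1 t x) (at x)"
    "(U1 t has_real_derivative U2 t x) (at x)" "(U2 t has_real_derivative U3 t x) (at x)"
    if "d \<le> t" for t x
    unfolding refl_cdf_def[abs_def] U1_def[abs_def] U2_def[abs_def] U3_def e_def[symmetric] using that assms
    by (auto intro!: DERIV_diff DERIV_cmult DERIV_heat_sol DERIV_heat_sol1 DERIV_heat_sol2)
  have B: "\<bar>U1 t x\<bar> \<le> C'" "\<bar>U2 t x\<bar> \<le> C'" "\<bar>U3 t x\<bar> \<le> C'" if "d \<le> t" for t x
    unfolding U1_def U2_def U3_def by (intro comb C that)+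
  then have C'0: "C' \<ge> 0" using abs_ge_zero[of "U1 d 0"] by (meson order.refl order_trans)
  \<comment> \<open>The Neumann condition. The two squares \<open>(r - \<alpha> * t)\<^sup>2\<close>
    and \<open>(r + \<alpha> * t)\<^sup>2\<close> differ by \<open>4 * \<alpha> * r * t\<close>, so
    after division by \<open>2 * t\<close> the weight \<open>exp (2 * \<alpha> * r)\<close> makes
    the two Gaussian slopes at 0 equal.\<close>
  have Z: "U1 t 0 = 0" if "d \<le> t" for t
  proof -
    have s: "t > 0" "(sqrt t)\<^sup>2 = t" using that assms by auto
    have "- ((r - \<alpha> * t) / sqrt t)\<^sup>2 / 2 = 2 * \<alpha> * r - ((- r - \<alpha> * t) / sqrt t)\<^sup>2 / 2"
      using s by (simp add: power_divide field_simps) (simp add: power2_eq_square algebra_simps)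
    then have "exp (- ((r - \<alpha> * t) / sqrt t)\<^sup>2 / 2) = e * exp (- ((- r - \<alpha> * t) / sqrt t)\<^sup>2 / 2)"
      by (simp add: e_def exp_add[symmetric])
    then have "std_normal_density ((r - \<alpha> * t) / sqrt t) = e * std_normal_density ((- r - \<alpha> * t) / sqrt t)"
      unfolding std_normal_density_def by (simp only: mult_ac)
    then show ?thesis
      by (simp add: U1_def heat_sol1_def heat_arg_def)
  qed
  show thesis
  proof (rule that[of U1 U2 "6 * C'"])
    fix t x y assume t: "d \<le> t"
    show "\<bar>refl_cdf \<alpha> r t (\<bar>y\<bar>) - refl_cdf \<alpha> r t (\<bar>x\<bar>)
        - (if x \<le> 0 then - U1 t (\<bar>x\<bar>) else U1 t (\<bar>x\<bar>)) * (y - x) - U2 t (\<bar>x\<bar>) / 2 * (y - x)\<^sup>2\<bar>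
      \<le> 6 * C' * min (\<bar>y - x\<bar> ^ 3) ((y - x)\<^sup>2)"
      by (rule taylor_even_extension[OF D[OF t] B(2,3)[OF t] Z[OF t]])
    show "\<bar>U1 t x\<bar> \<le> 6 * C'" "\<bar>U2 t x\<bar> \<le> 6 * C'"
      using B[OF t, of x] C'0 by linarith+
  next
    fix t assume "d \<le> t"
    then show "U1 t \<in> borel_measurable borel" "U2 t \<in> borel_measurable borel"
      using D(2,3) by (intro borel_measurable_continuous_onI continuous_at_imp_continuous_on; metis DERIV_isCont)+
  next
    fix t h x assume t: "d \<le> t" and "h \<ge> (0::real)"
    define f1 where "f1 s = U2 s x / 2 + \<alpha> * U1 s x" for s
    have E1: "((\<lambda>s. refl_cdf \<alpha> r s x) has_real_derivative f1 s) (at s)" if "d \<le> s" for s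
    proof -
      have "s > 0" using that assms by linarith
      from DERIV_diff[OF DERIV_heat_sol_t[OF this] DERIV_cmult[OF DERIV_heat_sol_t[OF this]]]
      have "((\<lambda>s. refl_cdf \<alpha> r s x) has_real_derivative heat_sol2 \<alpha> r s x / 2 + \<alpha> * heat_sol1 \<alpha> r s x
          - e * (heat_sol2 \<alpha> (- r) s x / 2 + \<alpha> * heat_sol1 \<alpha> (- r) s x)) (at s)"
        unfolding refl_cdf_def e_def .
      then show ?thesis
        by (simp add: f1_def U1_def U2_def algebra_simps diff_divide_distrib)
    qed
    have "\<exists>D. \<bar>D\<bar> \<le> C' \<and> (f1 has_real_derivative D) (at s)" if s: "d \<le> s" for s
    proof -
      obtain D1 where D1: "\<bar>D1\<bar> \<le> C"
         "((\<lambda>t. heat_sol2 \<alpha> r t x / 2 + \<alpha> * heat_sol1 \<alpha> r t x) has_real_derivative D1) (at s)"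
        using C(4)[OF s] by blast
      obtain D2 where D2: "\<bar>D2\<bar> \<le> C"
         "((\<lambda>t. heat_sol2 \<alpha> (-r) t x / 2 + \<alpha> * heat_sol1 \<alpha> (-r) t x) has_real_derivative D2) (at s)"
        using C(4)[OF s] by blast
      have "(f1 has_real_derivative D1 - e * D2) (at s)"
        using DERIV_diff[OF D1(2) DERIV_cmult[OF D2(2), of e]]
        by (simp add: f1_def[abs_def] U1_def U2_def algebra_simps diff_divide_distrib)
      then show ?thesis using comb[OF D1(1) D2(1)] by blast
    qed
    then obtain f2 where f2: "\<bar>f2 s\<bar> \<le> C'" "(f1 has_real_derivative f2 s) (at s)" if "d \<le> s" for s
      by metis
    have "\<bar>refl_cdf \<alpha> r (t + h) x - refl_cdf \<alpha> r t x - f1 t * (t + h - t)\<bar> \<le> C' * (t + h - t)\<^sup>2"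
      by (rule taylor_remainder_quadratic[of t "t + h" "\<lambda>s. refl_cdf \<alpha> r s x" f1 f2])
        (use \<open>h \<ge> 0\<close> t in \<open>auto intro!: E1 f2\<close>)
    also have "\<dots> \<le> 6 * C' * h\<^sup>2" using C'0 by (simp add: mult_right_mono)
    finally show "\<bar>refl_cdf \<alpha> r (t + h) x - refl_cdf \<alpha> r t x - (U2 t x / 2 + \<alpha> * U1 t x) * h\<bar> \<le> 6 * C' * h\<^sup>2"
      by (simp add: f1_def)
  qed
qed

section \<open>The bandit distribution folded at its centre\<close>

lemma Phi_mono: "x \<le> y \<Longrightarrow> Phi x \<le> Phi y"
  by (rule finite_borel_measure.cdf_nondecreasing)
    (rule real_distribution.finite_borel_measure_M[OF real_distribution_std_normal])

lemma refl_cdf_1: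
  "refl_cdf \<alpha> r 1 x = Phi (r - x - \<alpha>) - exp (2 * \<alpha> * r) * Phi (- r - x - \<alpha>)"
  by (simp add: refl_cdf_def heat_sol_def heat_arg_def)

lemma refl_cdf_le_1: "refl_cdf \<alpha> r t x \<le> 1"
  using Phi_bounds[of "heat_arg \<alpha> r t x"]
    mult_nonneg_nonneg[OF exp_ge_zero Phi_bounds(1), of "2 * \<alpha> * r" "heat_arg \<alpha> (- r) t x"]
  unfolding refl_cdf_def heat_sol_def by linarith

text \<open>The density enters a measure through \<open>ennreal\<close>, which cuts off negative
  values, so its sign matters. For \<open>\<alpha> > 0\<close> one has
  \<open>\<alpha> \<le> z\<close>, so \<open>mills_ratio_bound\<close> replaces the tail by a
  Gaussian; completing the square and \<open>\<bar>y - \<beta>\<bar> \<le> r + x\<close> show that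
  this Gaussian is at most the first term.\<close>

lemma bandit_density_nonneg: "0 \<le> bandit_density \<alpha> \<beta> c y"
proof (cases "\<alpha> \<le> 0")
  case True
  have "\<alpha> * (exp (2 * \<alpha> * \<bar>y - c\<bar>) * Phi (- \<bar>c - \<beta>\<bar> - \<bar>y - c\<bar> - \<alpha>)) \<le> 0"
    using True by (intro mult_nonpos_nonneg mult_nonneg_nonneg Phi_bounds) auto
  moreover have "0 \<le> 1 / sqrt (2 * pi) *
       exp (- (((y - \<beta>)\<^sup>2 - 2 * \<alpha> * (\<bar>y - c\<bar> - \<bar>c - \<beta>\<bar>) + \<alpha>\<^sup>2) / 2))" by simp
  ultimately show ?thesis unfolding bandit_density_def by (simp only: mult.assoc)
next
  case False
  define r x where "r = \<bar>y - c\<bar>" and "x = \<bar>c - \<beta>\<bar>"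
  define z where "z = x + r + \<alpha>"
  have "\<alpha> * Phi (- z) \<le> z * Phi (- z)"
    using Phi_bounds by (intro mult_right_mono) (auto simp: z_def r_def x_def)
  also have "\<dots> \<le> std_normal_density z" by (rule mills_ratio_bound)
  finally have "exp (2 * \<alpha> * r) * (\<alpha> * Phi (- z)) \<le> exp (2 * \<alpha> * r) * std_normal_density z"
    by (intro mult_left_mono) auto
  also have "\<dots> = 1 / sqrt (2 * pi) * exp (2 * \<alpha> * r - z\<^sup>2 / 2)"
    by (simp add: std_normal_density_def mult_exp_exp)
  also have "\<dots> \<le> 1 / sqrt (2 * pi) * exp (- (((y - \<beta>)\<^sup>2 - 2 * \<alpha> * (r - x) + \<alpha>\<^sup>2) / 2))"
  proof -
    have "\<bar>y - \<beta>\<bar> \<le> \<bar>r + x\<bar>" unfolding r_def x_def by linarith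
    then have "(y - \<beta>)\<^sup>2 \<le> (r + x)\<^sup>2" by (simp only: abs_le_square_iff)
    moreover have "2 * \<alpha> * r - z\<^sup>2 / 2 = - (((r + x)\<^sup>2 - 2 * \<alpha> * (r - x) + \<alpha>\<^sup>2) / 2)"
      by (simp add: z_def power2_eq_square field_simps)
    ultimately have "2 * \<alpha> * r - z\<^sup>2 / 2 \<le> - (((y - \<beta>)\<^sup>2 - 2 * \<alpha> * (r - x) + \<alpha>\<^sup>2) / 2)"
      by simp
    then show ?thesis by (intro mult_left_mono) auto
  qed
  finally have "\<alpha> * exp (2 * \<alpha> * r) * Phi (- z) \<le> 1 / sqrt (2 * pi) * exp (- (((y - \<beta>)\<^sup>2 - 2 * \<alpha> * (r - x) + \<alpha>\<^sup>2) / 2))"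
    by (simp only: mult_ac)
  moreover have "- z = - x - r - \<alpha>" by (simp add: z_def)
  ultimately show ?thesis
    unfolding bandit_density_def r_def[symmetric] x_def[symmetric] by simp
qed

text \<open>The derivative is taken in the level, not in the starting point. The product rule on the
  image term yields the tail with factor \<open>2 * \<alpha>\<close>, one \<open>\<alpha>\<close>
  for each of the points \<open>c + r\<close> and \<open>c - r\<close>, and a second Gaussian once
  the exponential weight is absorbed by completing the square.\<close>

lemma DERIV_refl_cdf:
  assumes "r \<ge> 0"
  shows "((\<lambda>r. refl_cdf \<alpha> r 1 \<bar>\<beta> - c\<bar>) has_real_derivative
    (bandit_density \<alpha> \<beta> c (c + r) + bandit_density \<alpha> \<beta> c (c - r))) (at r)"
proof -
  define x where "x = \<bar>\<beta> - c\<bar>"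
  have x: "\<bar>c - \<beta>\<bar> = x" by (simp add: x_def abs_minus_commute)
  have g: "g = - r - x - \<alpha> \<Longrightarrow> exp (2 * \<alpha> * r) * std_normal_density g =
    1 / sqrt (2 * pi) * exp (- (((r + x)\<^sup>2 - 2 * \<alpha> * (r - x) + \<alpha>\<^sup>2) / 2))" for g
  proof -
    assume g: "g = - r - x - \<alpha>"
    have "2 * \<alpha> * r - g\<^sup>2 / 2 = - (((r + x)\<^sup>2 - 2 * \<alpha> * (r - x) + \<alpha>\<^sup>2) / 2)"
      unfolding g by (simp add: power2_eq_square field_simps)
    then show ?thesis
      by (simp add: std_normal_density_def mult_exp_exp)
  qed
  have "((\<lambda>r. refl_cdf \<alpha> r 1 x) has_real_derivative
     (std_normal_density (r - x - \<alpha>) - (2 * \<alpha> * exp (2 * \<alpha> * r) * Phi (- r - x - \<alpha>)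
      - exp (2 * \<alpha> * r) * std_normal_density (- r - x - \<alpha>)))) (at r)"
    unfolding refl_cdf_1
    by (rule derivative_eq_intros refl DERIV_chain2[OF DERIV_Phi])+
      (simp del: std_normal_density_def add: algebra_simps)
  also have "std_normal_density (r - x - \<alpha>) =
     1 / sqrt (2 * pi) * exp (- (((r - x)\<^sup>2 - 2 * \<alpha> * (r - x) + \<alpha>\<^sup>2) / 2))"
    unfolding std_normal_density_def by (simp add: power2_eq_square field_simps)
  also note g[OF refl]
  also have "1 / sqrt (2 * pi) * exp (- (((r - x)\<^sup>2 - 2 * \<alpha> * (r - x) + \<alpha>\<^sup>2) / 2)) -
      (2 * \<alpha> * exp (2 * \<alpha> * r) * Phi (- r - x - \<alpha>) -
       1 / sqrt (2 * pi) * exp (- (((r + x)\<^sup>2 - 2 * \<alpha> * (r - x) + \<alpha>\<^sup>2) / 2)))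
    = bandit_density \<alpha> \<beta> c (c + r) + bandit_density \<alpha> \<beta> c (c - r)"
  proof -
    \<comment> \<open>One of \<open>c + r\<close>, \<open>c - r\<close> is at distance
      \<open>\<bar>r - x\<bar>\<close> from \<open>\<beta>\<close> and the other at distance
      \<open>r + x\<close>. Which is which depends on the side of \<open>c\<close> that
      \<open>\<beta>\<close> lies on, but the sum of the densities does not.\<close>
    have sq: "(c + r - \<beta>)\<^sup>2 = (if \<beta> \<ge> c then (r - x)\<^sup>2 else (r + x)\<^sup>2)"
      "(c - r - \<beta>)\<^sup>2 = (if \<beta> \<ge> c then (r + x)\<^sup>2 else (r - x)\<^sup>2)"
      unfolding x_def by (auto simp: power2_eq_square algebra_simps)
    have a: "\<bar>c + r - c\<bar> = r" "\<bar>c - r - c\<bar> = r" using assms by auto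
    have e: "- x - r - \<alpha> = - r - x - \<alpha>" by simp
    show ?thesis
      unfolding bandit_density_def x a sq e by (cases "\<beta> \<ge> c") simp_all
  qed
  finally show ?thesis unfolding x_def .
qed

lemma borel_measurable_bandit_density [measurable]:
  "bandit_density \<alpha> \<beta> c \<in> borel_measurable borel"
  unfolding bandit_density_def[abs_def] by measurable

text \<open>Folding the interval at \<open>c\<close> turns the mass into the integral of the
  symmetrised density over \<open>{0..r}\<close>, whose antiderivative \<open>DERIV_refl_cdf\<close>
  provides. The antiderivative vanishes at level 0, where the two terms of \<open>refl_cdf\<close>
  coincide.\<close>

lemma emeasure_bandit_distribution_Icc:
  assumes "r \<ge> 0"
  shows "emeasure (bandit_distribution \<alpha> \<beta> c) {c - r..c + r} = ennreal (refl_cdf \<alpha> r 1 \<bar>\<beta> - c\<bar>)"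
proof -
  let ?f = "bandit_density \<alpha> \<beta> c"
  let ?F = "\<lambda>r. refl_cdf \<alpha> r 1 \<bar>\<beta> - c\<bar>"
  have "emeasure (bandit_distribution \<alpha> \<beta> c) {c - r..c + r} =
      (\<integral>\<^sup>+y. ennreal (?f y) * indicator {c - r..c + r} y \<partial>lborel)"
    unfolding bandit_distribution_def by (subst emeasure_density) auto
  also have "\<dots> = (\<integral>\<^sup>+y. ennreal (?f y) * indicator {c..c + r} y + ennreal (?f y) * indicator {c - r..c} y \<partial>lborel)"
  proof (rule nn_integral_cong_AE)
    show "AE y in lborel. ennreal (?f y) * indicator {c - r..c + r} y =
        ennreal (?f y) * indicator {c..c + r} y + ennreal (?f y) * indicator {c - r..c} y"
      using AE_lborel_singleton[of c] by eventually_elim (use assms in \<open>auto split: split_indicator\<close>)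
  qed
  also have "\<dots> = (\<integral>\<^sup>+y. ennreal (?f y) * indicator {c..c + r} y \<partial>lborel) +
      (\<integral>\<^sup>+y. ennreal (?f y) * indicator {c - r..c} y \<partial>lborel)"
    by (rule nn_integral_add) auto
  also have "(\<integral>\<^sup>+y. ennreal (?f y) * indicator {c..c + r} y \<partial>lborel) =
      (\<integral>\<^sup>+y. ennreal (?f (c + y)) * indicator {0..r} y \<partial>lborel)"
    by (subst nn_integral_real_affine[where t = c and c = 1])
      (auto intro!: nn_integral_cong split: split_indicator)
  also have "(\<integral>\<^sup>+y. ennreal (?f y) * indicator {c - r..c} y \<partial>lborel) =
      (\<integral>\<^sup>+y. ennreal (?f (c - y)) * indicator {0..r} y \<partial>lborel)"
    by (subst nn_integral_real_affine[where t = c and c = "-1"])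
      (auto intro!: nn_integral_cong split: split_indicator)
  also have "(\<integral>\<^sup>+y. ennreal (?f (c + y)) * indicator {0..r} y \<partial>lborel) + \<dots> =
      (\<integral>\<^sup>+y. ennreal (?f (c + y)) * indicator {0..r} y + ennreal (?f (c - y)) * indicator {0..r} y \<partial>lborel)"
    by (rule nn_integral_add[symmetric]) auto
  also have "\<dots> = (\<integral>\<^sup>+y. ennreal (?f (c + y) + ?f (c - y)) * indicator {0..r} y \<partial>lborel)"
    by (intro nn_integral_cong) (auto simp: bandit_density_nonneg split: split_indicator)
  also have "\<dots> = ennreal (?F r - ?F 0)"
    by (rule nn_integral_FTC_Icc) (auto intro!: DERIV_refl_cdf bandit_density_nonneg assms add_nonneg_nonneg)
  also have "?F 0 = 0" by (simp add: refl_cdf_1)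
  finally show ?thesis by simp
qed

text \<open>For \<open>\<alpha> > 0\<close> the image term is a growing exponential times a
  vanishing tail. Once the tail is bounded by the density, completing the square leaves a constant
  times a Gaussian centred at \<open>\<alpha> - x\<close>.\<close>

lemma refl_cdf_lim_1:
  assumes "x \<ge> 0"
  shows "((\<lambda>r. refl_cdf \<alpha> r 1 x) \<longlongrightarrow> 1) at_top"
proof -
  have 1: "((\<lambda>r. Phi (r - x - \<alpha>)) \<longlongrightarrow> 1) at_top"
    by (rule filterlim_compose[OF Phi_lim_top]) real_asymp
  have "((\<lambda>r. exp (2 * \<alpha> * r) * Phi (- (r + x + \<alpha>))) \<longlongrightarrow> 0) at_top"
  proof (rule tendsto_sandwich)
    show "eventually (\<lambda>r. 0 \<le> exp (2 * \<alpha> * r) * Phi (- (r + x + \<alpha>))) at_top"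
      by (simp add: Phi_bounds)
    show "eventually (\<lambda>r. exp (2 * \<alpha> * r) * Phi (- (r + x + \<alpha>)) \<le>
       exp (2 * \<alpha> * r) * std_normal_density (r + x + \<alpha>)) at_top"
      using eventually_ge_at_top[of "1 - x - \<alpha>"]
    proof eventually_elim
      case (elim r)
      have "1 * Phi (- (r + x + \<alpha>)) \<le> (r + x + \<alpha>) * Phi (- (r + x + \<alpha>))"
        using elim by (intro mult_right_mono Phi_bounds) auto
      also have "\<dots> \<le> std_normal_density (r + x + \<alpha>)" by (rule mills_ratio_bound)
      finally show ?case by (intro mult_left_mono) auto
    qed
    show "((\<lambda>r. exp (2 * \<alpha> * r) * std_normal_density (r + x + \<alpha>)) \<longlongrightarrow> 0) at_top"
    proof -
      have "exp (2 * \<alpha> * r) * std_normal_density (r + x + \<alpha>)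
          = exp (- (2 * \<alpha> * x)) * std_normal_density (r + (x - \<alpha>))" for r
      proof -
        have "2 * \<alpha> * r - (r + x + \<alpha>)\<^sup>2 / 2 = - (2 * \<alpha> * x) - (r + (x - \<alpha>))\<^sup>2 / 2"
          by (simp add: power2_eq_square field_simps)
        then show ?thesis
          by (simp add: std_normal_density_def mult_exp_exp)
      qed
      moreover have "((\<lambda>r. exp (- (2 * \<alpha> * x)) * std_normal_density (r + (x - \<alpha>))) \<longlongrightarrow>
          exp (- (2 * \<alpha> * x)) * 0) at_top"
        by (intro tendsto_mult tendsto_const filterlim_compose[OF std_normal_density_lim]) real_asymp
      ultimately show ?thesis by simp
    qed
  qed simp
  from tendsto_diff[OF 1 this] show ?thesis
    by (simp add: refl_cdf_1 algebra_simps)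
qed

text \<open>The total mass is the limit of the masses of growing intervals around \<open>c\<close>,
  which are already known in closed form.\<close>

lemma prob_space_bandit_distribution: "prob_space (bandit_distribution \<alpha> \<beta> c)"
proof
  let ?B = "bandit_distribution \<alpha> \<beta> c"
  have "(\<lambda>n. emeasure ?B {c - real n..c + real n}) \<longlonglongrightarrow> emeasure ?B (\<Union>n. {c - real n..c + real n})"
    by (rule Lim_emeasure_incseq) (auto simp: incseq_def bandit_distribution_def)
  moreover have "(\<Union>n. {c - real n..c + real n}) = space ?B"
  proof -
    have "\<exists>n. y \<in> {c - real n..c + real n}" for y
    proof -
      obtain n where "\<bar>y - c\<bar> \<le> real n" using real_arch_simple by blast
      then show ?thesis by (intro exI[of _ n]) auto
    qed
    then show ?thesis by (auto simp: bandit_distribution_def)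
  qed
  moreover have "(\<lambda>n. ennreal (refl_cdf \<alpha> (real n) 1 \<bar>\<beta> - c\<bar>)) \<longlonglongrightarrow> ennreal 1"
    by (intro tendsto_ennrealI filterlim_compose[OF refl_cdf_lim_1 filterlim_real_sequentially]) simp
  ultimately show "emeasure ?B (space ?B) = 1"
    by (simp add: emeasure_bandit_distribution_Icc) (metis LIMSEQ_unique)
qed

section \<open>The folded law, and convergence in law from smooth test functions\<close>

definition folded_bandit :: "real \<Rightarrow> real \<Rightarrow> real \<Rightarrow> real measure" where
  "folded_bandit \<alpha> \<beta> c = distr (bandit_distribution \<alpha> \<beta> c) borel (\<lambda>y. \<bar>y - c\<bar>)"

lemma real_distribution_folded_bandit: "real_distribution (folded_bandit \<alpha> \<beta> c)"
  unfolding folded_bandit_def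
  by (intro prob_space.real_distribution_distr[OF prob_space_bandit_distribution])
    (simp add: bandit_distribution_def)

lemma cdf_folded_bandit:
  "cdf (folded_bandit \<alpha> \<beta> c) r = (if r < 0 then 0 else refl_cdf \<alpha> r 1 \<bar>\<beta> - c\<bar>)"
proof -
  interpret B: prob_space "bandit_distribution \<alpha> \<beta> c"
    by (rule prob_space_bandit_distribution)
  have "cdf (folded_bandit \<alpha> \<beta> c) r = measure (bandit_distribution \<alpha> \<beta> c) {c - r..c + r}"
    unfolding cdf_def folded_bandit_def
    by (subst measure_distr) (auto simp: bandit_distribution_def intro!: arg_cong2[where f = measure])
  \<comment> \<open>Reading a real value back from \<open>ennreal\<close> requires its sign. It
    follows from monotonicity in the level, starting from 0 at level 0.\<close>
  moreover have "refl_cdf \<alpha> r 1 \<bar>\<beta> - c\<bar> \<ge> 0" if "r \<ge> 0"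
  proof -
    have "refl_cdf \<alpha> 0 1 \<bar>\<beta> - c\<bar> \<le> refl_cdf \<alpha> r 1 \<bar>\<beta> - c\<bar>"
      using that
    proof (rule DERIV_nonneg_imp_nondecreasing)
      fix s :: real assume "0 \<le> s"
      then show "\<exists>y. ((\<lambda>r. refl_cdf \<alpha> r 1 \<bar>\<beta> - c\<bar>) has_real_derivative y) (at s) \<and> 0 \<le> y"
        using DERIV_refl_cdf[of s \<alpha> \<beta> c] bandit_density_nonneg by (meson add_nonneg_nonneg)
    qed
    then show ?thesis by (simp add: refl_cdf_1)
  qed
  ultimately show ?thesis
    using emeasure_bandit_distribution_Icc[of r \<alpha> \<beta> c] by (auto simp: measure_def)
qed

text \<open>At time \<open>\<epsilon> ^ 4\<close> the Gaussian has standard deviation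
  \<open>\<epsilon>\<^sup>2\<close>, far below the gap \<open>\<epsilon>\<close>; a point at
  distance \<open>\<epsilon>\<close> from the level is therefore about \<open>1 / \<epsilon>\<close>
  deviations away, and \<open>w\<close> is this number less the largest effect of the drift. The
  assumption \<open>\<epsilon> \<le> s\<close> keeps the image level \<open>- s\<close> equally far
  away. Bounding \<open>s\<close> by \<open>R\<close> makes \<open>\<eta>\<close> independent of the
  level.\<close>

lemma refl_cdf_indicator_bounds:
  fixes \<alpha> \<epsilon> s R x :: real
  defines "w \<equiv> 1 / \<epsilon> - \<bar>\<alpha>\<bar> * \<epsilon>\<^sup>2"
  defines "\<eta> \<equiv> 1 - Phi w + (1 + exp (2 * \<bar>\<alpha>\<bar> * R)) * Phi (- w)"
  assumes "0 < \<epsilon>" "\<epsilon> \<le> s" "s \<le> R" "0 \<le> x"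
  shows "indicator {..s - \<epsilon>} x - \<eta> \<le> refl_cdf \<alpha> s (\<epsilon> ^ 4) x"
    and "refl_cdf \<alpha> s (\<epsilon> ^ 4) x \<le> indicator {..s + \<epsilon>} x + \<eta>"
proof -
  have sq: "sqrt (\<epsilon> ^ 4) = \<epsilon>\<^sup>2"
    using assms by (intro real_sqrt_unique) auto
  have ha: "heat_arg \<alpha> k (\<epsilon> ^ 4) x = (k - x) / \<epsilon>\<^sup>2 - \<alpha> * \<epsilon>\<^sup>2" for k
    using assms unfolding heat_arg_def sq by (simp add: field_simps eval_nat_numeral)
  have ab: "\<bar>\<alpha> * \<epsilon>\<^sup>2\<bar> \<le> \<bar>\<alpha>\<bar> * \<epsilon>\<^sup>2" by (simp add: abs_mult)
  have up: "heat_arg \<alpha> k (\<epsilon> ^ 4) x \<le> - w" if "k - x \<le> - \<epsilon>" for k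
  proof -
    have "(k - x) / \<epsilon>\<^sup>2 \<le> - \<epsilon> / \<epsilon>\<^sup>2" using that by (intro divide_right_mono) auto
    also have "\<dots> = - (1 / \<epsilon>)" by (simp add: power2_eq_square)
    finally show ?thesis using ab unfolding ha w_def by linarith
  qed
  have lo: "w \<le> heat_arg \<alpha> k (\<epsilon> ^ 4) x" if "\<epsilon> \<le> k - x" for k
  proof -
    have "1 / \<epsilon> = \<epsilon> / \<epsilon>\<^sup>2" by (simp add: power2_eq_square)
    also have "\<dots> \<le> (k - x) / \<epsilon>\<^sup>2" using that by (intro divide_right_mono) auto
    finally show ?thesis using ab unfolding ha w_def by linarith
  qed
  have p1: "exp (2 * \<alpha> * s) * heat_sol \<alpha> (- s) (\<epsilon> ^ 4) x \<le> exp (2 * \<bar>\<alpha>\<bar> * R) * Phi (- w)"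
  proof (rule mult_mono)
    have "\<alpha> * s \<le> \<bar>\<alpha>\<bar> * R" using assms by (intro mult_mono) auto
    then show "exp (2 * \<alpha> * s) \<le> exp (2 * \<bar>\<alpha>\<bar> * R)" by simp
    show "heat_sol \<alpha> (- s) (\<epsilon> ^ 4) x \<le> Phi (- w)"
      unfolding heat_sol_def using assms by (intro Phi_mono up) auto
  qed (auto simp: Phi_bounds heat_sol_def)
  have p2: "0 \<le> exp (2 * \<alpha> * s) * heat_sol \<alpha> (- s) (\<epsilon> ^ 4) x"
    by (simp add: Phi_bounds heat_sol_def)
  have p3: "0 \<le> heat_sol \<alpha> s (\<epsilon> ^ 4) x" "heat_sol \<alpha> s (\<epsilon> ^ 4) x \<le> 1"
    by (simp_all add: Phi_bounds heat_sol_def)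
  have p4: "0 \<le> Phi w" "Phi w \<le> 1" "0 \<le> Phi (- w)" "0 \<le> exp (2 * \<bar>\<alpha>\<bar> * R) * Phi (- w)"
    by (simp_all add: Phi_bounds)
  have \<eta>: "\<eta> = 1 - Phi w + Phi (- w) + exp (2 * \<bar>\<alpha>\<bar> * R) * Phi (- w)"
    by (simp add: \<eta>_def algebra_simps)
  show "indicator {..s - \<epsilon>} x - \<eta> \<le> refl_cdf \<alpha> s (\<epsilon> ^ 4) x"
  proof (cases "x \<le> s - \<epsilon>")
    case True
    then have "Phi w \<le> heat_sol \<alpha> s (\<epsilon> ^ 4) x"
      unfolding heat_sol_def by (intro Phi_mono lo) auto
    then show ?thesis using True p1 p4 unfolding refl_cdf_def \<eta> by simp
  next
    case False
    then show ?thesis using p1 p3 p4 unfolding refl_cdf_def \<eta> by simp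
  qed
  show "refl_cdf \<alpha> s (\<epsilon> ^ 4) x \<le> indicator {..s + \<epsilon>} x + \<eta>"
  proof (cases "x \<le> s + \<epsilon>")
    case True
    then have "indicator {..s + \<epsilon>} x = (1 :: real)" by simp
    then show ?thesis using p2 p3 p4 unfolding refl_cdf_def \<eta> by linarith
  next
    case False
    then have "heat_sol \<alpha> s (\<epsilon> ^ 4) x \<le> Phi (- w)"
      unfolding heat_sol_def by (intro Phi_mono up) auto
    moreover have "indicator {..s + \<epsilon>} x = (0 :: real)" using False by simp
    ultimately show ?thesis using p2 p4 unfolding refl_cdf_def \<eta> by linarith
  qed
qed

lemma borel_measurable_refl_cdf [measurable]: "refl_cdf \<alpha> r t \<in> borel_measurable borel"
  unfolding refl_cdf_def[abs_def] heat_sol_def heat_arg_def by measurable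

lemma abs_refl_cdf_le: "\<bar>refl_cdf \<alpha> r t x\<bar> \<le> 1 + exp (2 * \<alpha> * r)"
proof -
  have "exp (2 * \<alpha> * r) * heat_sol \<alpha> (- r) t x \<le> exp (2 * \<alpha> * r) * 1"
    by (intro mult_left_mono) (auto simp: heat_sol_def Phi_bounds)
  moreover have "0 \<le> heat_sol \<alpha> r t x" by (simp add: heat_sol_def Phi_bounds)
  ultimately show ?thesis
    using refl_cdf_le_1[of \<alpha> r t x] exp_gt_zero[of "2 * \<alpha> * r"]
    unfolding refl_cdf_def by linarith
qed

text \<open>
  The smooth test functions at times \<open>\<delta> = \<epsilon> ^ 4\<close> and levels \<open>r \<plusminus> \<epsilon>\<close> sandwich the indicator of \<open>\<bar>x\<bar> \<le> r\<close>.
\<close>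
lemma (in prob_space) prob_abs_le_limit:
  fixes Y :: "nat \<Rightarrow> 'a \<Rightarrow> real"
  assumes [measurable]: "\<And>n. random_variable borel (Y n)"
    and conv: "\<And>\<delta> s. \<delta> > 0 \<Longrightarrow> s > 0 \<Longrightarrow>
      (\<lambda>n. expectation (\<lambda>\<omega>. refl_cdf \<alpha> s \<delta> \<bar>Y n \<omega>\<bar>)) \<longlonglongrightarrow> refl_cdf \<alpha> s (1 + \<delta>) x"
    and r: "r \<ge> 0"
  shows "(\<lambda>n. prob {\<omega> \<in> space M. \<bar>Y n \<omega>\<bar> \<le> r}) \<longlonglongrightarrow> refl_cdf \<alpha> r 1 x"
proof (rule LIMSEQ_I)
  fix e :: real assume e: "e > 0"
  define w where "w \<epsilon> = 1 / \<epsilon> - \<bar>\<alpha>\<bar> * \<epsilon>\<^sup>2" for \<epsilon> :: real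
  \<comment> \<open>The bound \<open>r + 1\<close> covers both levels \<open>r + \<epsilon>\<close>
    and \<open>r - \<epsilon>\<close>, since \<open>\<epsilon> < 1\<close>.\<close>
  define \<eta> where "\<eta> \<epsilon> = 1 - Phi (w \<epsilon>) + (1 + exp (2 * \<bar>\<alpha>\<bar> * (r + 1))) * Phi (- w \<epsilon>)" for \<epsilon> :: real
  let ?F = "refl_cdf \<alpha> r 1 x"
  have w: "filterlim w at_top (at_right 0)"
    unfolding w_def[abs_def] by real_asymp
  have "(\<eta> \<longlongrightarrow> 1 - 1 + (1 + exp (2 * \<bar>\<alpha>\<bar> * (r + 1))) * 0) (at_right 0)"
    unfolding \<eta>_def[abs_def]
    by (intro tendsto_intros filterlim_compose[OF Phi_lim_top w]
        filterlim_compose[OF Phi_lim_bot] filterlim_compose[OF filterlim_uminus_at_bot_at_top w])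
  then have ev1: "eventually (\<lambda>\<epsilon>. \<eta> \<epsilon> < e / 3) (at_right 0)"
    by (rule order_tendstoD(2)) (use e in simp)
  have "((\<lambda>\<epsilon>. refl_cdf \<alpha> (r + q * \<epsilon>) (1 + \<epsilon> ^ 4) x) \<longlongrightarrow> ?F) (at_right 0)" for q
    unfolding refl_cdf_def heat_sol_def heat_arg_def
    by (rule tendsto_eq_intros isCont_tendsto_compose[OF isCont_Phi] refl | simp)+
  then have ev2: "eventually (\<lambda>\<epsilon>. \<bar>refl_cdf \<alpha> (r + q * \<epsilon>) (1 + \<epsilon> ^ 4) x - ?F\<bar> < e / 3) (at_right 0)" for q
    using e unfolding tendsto_iff dist_real_def by (meson divide_pos_pos zero_less_numeral)
  \<comment> \<open>For \<open>r > 0\<close> the restriction \<open>\<epsilon> < r / 2\<close> gives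
    \<open>\<epsilon> \<le> r - \<epsilon>\<close>, as the upper indicator bound at level
    \<open>r - \<epsilon>\<close> demands.\<close>
  have ev3: "eventually (\<lambda>\<epsilon>. 0 < \<epsilon> \<and> \<epsilon> < 1 \<and> (r > 0 \<longrightarrow> \<epsilon> < r / 2)) (at_right (0::real))"
  proof -
    have "eventually (\<lambda>\<epsilon>. \<epsilon> \<in> {0<..<min 1 (if r > 0 then r / 2 else 1)}) (at_right (0::real))"
      by (rule eventually_at_right_real) auto
    then show ?thesis by eventually_elim auto
  qed
  have "eventually (\<lambda>\<epsilon>. (0 < \<epsilon> \<and> \<epsilon> < 1 \<and> (r > 0 \<longrightarrow> \<epsilon> < r / 2)) \<and> \<eta> \<epsilon> < e / 3 \<and>
     \<bar>refl_cdf \<alpha> (r + 1 * \<epsilon>) (1 + \<epsilon> ^ 4) x - ?F\<bar> < e / 3 \<and>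
     \<bar>refl_cdf \<alpha> (r + (- 1) * \<epsilon>) (1 + \<epsilon> ^ 4) x - ?F\<bar> < e / 3) (at_right 0)"
    by (intro eventually_conj ev1 ev2 ev3)
  then obtain \<epsilon> where \<epsilon>: "0 < \<epsilon>" "\<epsilon> < 1" "r > 0 \<longrightarrow> \<epsilon> < r / 2" "\<eta> \<epsilon> < e / 3"
     "\<bar>refl_cdf \<alpha> (r + \<epsilon>) (1 + \<epsilon> ^ 4) x - ?F\<bar> < e / 3"
     "\<bar>refl_cdf \<alpha> (r - \<epsilon>) (1 + \<epsilon> ^ 4) x - ?F\<bar> < e / 3"
    using eventually_happens[of _ "at_right (0::real)"] by auto
  have int: "integrable M (\<lambda>\<omega>. refl_cdf \<alpha> s t \<bar>Y n \<omega>\<bar>)" for s t n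
    by (rule integrable_const_bound[of _ "1 + exp (2 * \<alpha> * s)"]) (auto simp: abs_refl_cdf_le)
  have P: "prob {\<omega> \<in> space M. \<bar>Y n \<omega>\<bar> \<le> r} = expectation (\<lambda>\<omega>. indicator {..r} \<bar>Y n \<omega>\<bar>)" for n
  proof -
    have "expectation (\<lambda>\<omega>. indicator {..r} \<bar>Y n \<omega>\<bar>) = expectation (indicator {\<omega> \<in> space M. \<bar>Y n \<omega>\<bar> \<le> r})"
      by (intro Bochner_Integration.integral_cong) (auto split: split_indicator)
    also have "\<dots> = prob ({\<omega> \<in> space M. \<bar>Y n \<omega>\<bar> \<le> r} \<inter> space M)"
      by (rule Bochner_Integration.integral_indicator)
    also have "{\<omega> \<in> space M. \<bar>Y n \<omega>\<bar> \<le> r} \<inter> space M = {\<omega> \<in> space M. \<bar>Y n \<omega>\<bar> \<le> r}" by auto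
    finally show ?thesis by simp
  qed
  have inti: "integrable M (\<lambda>\<omega>. indicator {..r} \<bar>Y n \<omega>\<bar> :: real)" for n
    by (rule integrable_const_bound[of _ 1]) auto
  have up: "prob {\<omega> \<in> space M. \<bar>Y n \<omega>\<bar> \<le> r} - \<eta> \<epsilon> \<le> expectation (\<lambda>\<omega>. refl_cdf \<alpha> (r + \<epsilon>) (\<epsilon> ^ 4) \<bar>Y n \<omega>\<bar>)" for n
  proof -
    have "prob {\<omega> \<in> space M. \<bar>Y n \<omega>\<bar> \<le> r} - \<eta> \<epsilon> = expectation (\<lambda>\<omega>. indicator {..r} \<bar>Y n \<omega>\<bar> - \<eta> \<epsilon>)"
      unfolding P using inti by (simp add: prob_space)
    also have "\<dots> \<le> expectation (\<lambda>\<omega>. refl_cdf \<alpha> (r + \<epsilon>) (\<epsilon> ^ 4) \<bar>Y n \<omega>\<bar>)"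
      using refl_cdf_indicator_bounds(1)[of \<epsilon> "r + \<epsilon>" "r + 1" _ \<alpha>] r \<epsilon>
      by (intro integral_mono int Bochner_Integration.integrable_diff inti) (auto simp: \<eta>_def w_def)
    finally show ?thesis .
  qed
  have lo: "expectation (\<lambda>\<omega>. refl_cdf \<alpha> (r - \<epsilon>) (\<epsilon> ^ 4) \<bar>Y n \<omega>\<bar>) \<le> prob {\<omega> \<in> space M. \<bar>Y n \<omega>\<bar> \<le> r} + \<eta> \<epsilon>"
    if "r > 0" for n
  proof -
    have "expectation (\<lambda>\<omega>. refl_cdf \<alpha> (r - \<epsilon>) (\<epsilon> ^ 4) \<bar>Y n \<omega>\<bar>) \<le> expectation (\<lambda>\<omega>. indicator {..r} \<bar>Y n \<omega>\<bar> + \<eta> \<epsilon>)"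
      using refl_cdf_indicator_bounds(2)[of \<epsilon> "r - \<epsilon>" "r + 1" _ \<alpha>] that \<epsilon>
      by (intro integral_mono int Bochner_Integration.integrable_add inti) (auto simp: \<eta>_def w_def)
    also have "\<dots> = prob {\<omega> \<in> space M. \<bar>Y n \<omega>\<bar> \<le> r} + \<eta> \<epsilon>"
      unfolding P using inti by (simp add: prob_space)
    finally show ?thesis .
  qed
  have "eventually (\<lambda>n. \<bar>expectation (\<lambda>\<omega>. refl_cdf \<alpha> s (\<epsilon> ^ 4) \<bar>Y n \<omega>\<bar>) - refl_cdf \<alpha> s (1 + \<epsilon> ^ 4) x\<bar> < e / 3) sequentially"
    if "s > 0" for s
    using conv[of "\<epsilon> ^ 4" s] that \<epsilon>(1) e unfolding tendsto_iff dist_real_def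
    by (meson divide_pos_pos zero_less_numeral zero_less_power)
  note cv = this
  \<comment> \<open>At \<open>r = 0\<close> there is no positive level below \<open>r\<close>, but
    there the limit is 0 and the lower estimate holds trivially.\<close>
  have lo': "eventually (\<lambda>n. ?F - e < prob {\<omega> \<in> space M. \<bar>Y n \<omega>\<bar> \<le> r}) sequentially"
  proof (cases "r > 0")
    case True
    then have "r - \<epsilon> > 0" using \<epsilon>(1,3) by simp
    from cv[OF this] show ?thesis
    proof eventually_elim
      case (elim n)
      then show ?case using lo[OF True, of n] \<epsilon>(4,6) by linarith
    qed
  next
    case False
    then have "r = 0" using r by simp
    then have "?F = 0" by (simp add: refl_cdf_1)
    moreover have "- e < prob A" for A using e measure_nonneg[of M A] by linarith
    ultimately show ?thesis by simp
  qed
  have "r + \<epsilon> > 0" using r \<epsilon> by simp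
  from lo' cv[OF this] have "eventually (\<lambda>n. norm (prob {\<omega> \<in> space M. \<bar>Y n \<omega>\<bar> \<le> r} - ?F) < e) sequentially"
  proof eventually_elim
    case (elim n)
    then show ?case using up[of n] \<epsilon>(4,5) unfolding real_norm_def by linarith
  qed
  then show "\<exists>no. \<forall>n\<ge>no. norm (prob {\<omega> \<in> space M. \<bar>Y n \<omega>\<bar> \<le> r} - ?F) < e"
    by (simp add: eventually_sequentially)
qed

text \<open>By symmetry \<open>\<phi> (y + c)\<close> depends on \<open>\<bar>y\<bar>\<close> only,
  so both sides are integrals of one bounded continuous function against folded laws. Their
  distribution functions converge at every point by \<open>prob_abs_le_limit\<close>, which is weak
  convergence.\<close>

lemma (in prob_space) expectation_limit_of_refl_cdf:
  fixes Y :: "nat \<Rightarrow> 'a \<Rightarrow> real" and \<phi> :: "real \<Rightarrow> real"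
  assumes Y [measurable]: "\<And>n. random_variable borel (Y n)"
    and conv: "\<And>\<delta> s. \<delta> > 0 \<Longrightarrow> s > 0 \<Longrightarrow>
      (\<lambda>n. expectation (\<lambda>\<omega>. refl_cdf \<alpha> s \<delta> \<bar>Y n \<omega>\<bar>)) \<longlonglongrightarrow> refl_cdf \<alpha> s (1 + \<delta>) \<bar>\<beta> - c\<bar>"
    and cont: "continuous_on UNIV \<phi>" and sym: "\<And>x. \<phi> (x + c) = \<phi> (- x + c)"
    and bnd: "\<And>x. \<bar>\<phi> x\<bar> \<le> B"
  shows "(\<lambda>n. expectation (\<lambda>\<omega>. \<phi> (Y n \<omega> + c))) \<longlonglongrightarrow> (\<integral>y. \<phi> y \<partial>bandit_distribution \<alpha> \<beta> c)"
proof -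
  have [measurable]: "\<phi> \<in> borel_measurable borel"
    using cont by (rule borel_measurable_continuous_onI)
  have fold: "\<phi> (y + c) = \<phi> (\<bar>y\<bar> + c)" for y
    using sym[of y] by (cases "y \<ge> 0") auto
  define N where "N n = distr M borel (\<lambda>\<omega>. \<bar>Y n \<omega>\<bar>)" for n
  have N: "real_distribution (N n)" for n
    unfolding N_def by (intro real_distribution_distr) simp
  have cdfN: "cdf (N n) r = prob {\<omega> \<in> space M. \<bar>Y n \<omega>\<bar> \<le> r}" for n r
    unfolding cdf_def N_def by (subst measure_distr) (auto intro!: arg_cong2[where f = measure])
  have "weak_conv_m N (folded_bandit \<alpha> \<beta> c)"
    unfolding weak_conv_m_def weak_conv_def
  proof (intro allI impI)
    fix r
    show "(\<lambda>n. cdf (N n) r) \<longlonglongrightarrow> cdf (folded_bandit \<alpha> \<beta> c) r"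
    proof (cases "r < 0")
      case True
      then have "cdf (N n) r = prob {}" for n
        unfolding cdfN by (intro arg_cong[where f = prob]) auto
      then show ?thesis using True by (simp add: cdf_folded_bandit)
    next
      case False
      then show ?thesis
        unfolding cdfN cdf_folded_bandit using prob_abs_le_limit[OF Y conv, of r] by simp
    qed
  qed
  then have "(\<lambda>n. integral\<^sup>L (N n) (\<lambda>y. \<phi> (y + c))) \<longlonglongrightarrow> integral\<^sup>L (folded_bandit \<alpha> \<beta> c) (\<lambda>y. \<phi> (y + c))"
  proof (rule weak_conv_imp_integral_bdd_continuous_conv[OF N real_distribution_folded_bandit])
    fix x
    have "continuous_on UNIV (\<lambda>y. \<phi> (y + c))"
      by (rule continuous_on_compose2[OF cont]) (auto intro!: continuous_intros)
    then show "isCont (\<lambda>y. \<phi> (y + c)) x" by (simp add: continuous_on_eq_continuous_at)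
    show "norm (\<phi> (x + c)) \<le> B" using bnd by simp
  qed
  also have "(\<lambda>n. integral\<^sup>L (N n) (\<lambda>y. \<phi> (y + c))) = (\<lambda>n. expectation (\<lambda>\<omega>. \<phi> (Y n \<omega> + c)))"
    unfolding N_def by (subst integral_distr) (auto simp: fold[symmetric])
  also have "integral\<^sup>L (folded_bandit \<alpha> \<beta> c) (\<lambda>y. \<phi> (y + c)) = (\<integral>y. \<phi> y \<partial>bandit_distribution \<alpha> \<beta> c)"
    unfolding folded_bandit_def
    by (subst integral_distr) (auto simp: fold[symmetric] bandit_distribution_def)
  finally show ?thesis .
qed

section \<open>Telescoping along the random walk\<close>

text \<open>Here \<open>u\<close> is the test function after the step and \<open>v\<close> the one
  before it, with \<open>h\<close> more time left. Independence lets the increment be averaged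
  against functions of \<open>S\<close>. On \<open>S \<le> 0\<close> both the slope of the even
  extension and the mean of the increment change sign, so the first-order term is
  \<open>\<alpha> * h * u1\<close> on either side; together with half the variance it matches the
  time increment \<open>v - u\<close>.\<close>

lemma (in prob_space) one_step_error:
  fixes S S' \<xi>1 \<xi>2 :: "'a \<Rightarrow> real" and u v u1 u2 :: "real \<Rightarrow> real"
  assumes ind1: "indep_var borel S borel \<xi>1" and ind2: "indep_var borel S borel \<xi>2"
    and sq: "integrable M (\<lambda>\<omega>. (\<xi>1 \<omega>)\<^sup>2)" "integrable M (\<lambda>\<omega>. (\<xi>2 \<omega>)\<^sup>2)"
    and [measurable]: "random_variable borel S'"
    and S': "AE \<omega> in M. S' \<omega> = S \<omega> + (if S \<omega> \<le> 0 then \<xi>1 \<omega> else \<xi>2 \<omega>)"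
    and mean: "expectation \<xi>1 = - \<alpha> * h" "expectation \<xi>2 = \<alpha> * h"
    and var: "\<bar>expectation (\<lambda>\<omega>. (\<xi>1 \<omega>)\<^sup>2) - h\<bar> \<le> e" "\<bar>expectation (\<lambda>\<omega>. (\<xi>2 \<omega>)\<^sup>2) - h\<bar> \<le> e"
    and third: "expectation (\<lambda>\<omega>. min (\<bar>\<xi>1 \<omega>\<bar> ^ 3) ((\<xi>1 \<omega>)\<^sup>2)) \<le> \<rho>"
      "expectation (\<lambda>\<omega>. min (\<bar>\<xi>2 \<omega>\<bar> ^ 3) ((\<xi>2 \<omega>)\<^sup>2)) \<le> \<rho>"
    and [measurable]: "u \<in> borel_measurable borel" "v \<in> borel_measurable borel"
      "u1 \<in> borel_measurable borel" "u2 \<in> borel_measurable borel"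
    and bnd: "\<And>x. \<bar>u x\<bar> \<le> B" "\<And>x. \<bar>v x\<bar> \<le> B" "\<And>x. \<bar>u1 x\<bar> \<le> K" "\<And>x. \<bar>u2 x\<bar> \<le> K"
    and taylor: "\<And>x y. \<bar>u (\<bar>y\<bar>) - u (\<bar>x\<bar>) - (if x \<le> 0 then - u1 (\<bar>x\<bar>) else u1 (\<bar>x\<bar>)) * (y - x)
        - u2 (\<bar>x\<bar>) / 2 * (y - x)\<^sup>2\<bar> \<le> K * min (\<bar>y - x\<bar> ^ 3) ((y - x)\<^sup>2)"
    and time: "\<And>x. \<bar>v x - u x - (u2 x / 2 + \<alpha> * u1 x) * h\<bar> \<le> K * h\<^sup>2"
  shows "\<bar>expectation (\<lambda>\<omega>. u \<bar>S' \<omega>\<bar>) - expectation (\<lambda>\<omega>. v \<bar>S \<omega>\<bar>)\<bar> \<le> K * (2 * \<rho> + h\<^sup>2 + e)"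
proof -
  have [measurable]: "random_variable borel S" "random_variable borel \<xi>1" "random_variable borel \<xi>2"
    using ind1 ind2 by (auto dest: indep_var_rv1 indep_var_rv2)
  have K0: "K \<ge> 0" using bnd(3)[of 0] by linarith
  have int: "integrable M \<xi>1" "integrable M \<xi>2"
    using square_integrable_imp_integrable[OF _ sq(1)] square_integrable_imp_integrable[OF _ sq(2)] by auto
  \<comment> \<open>The four averages separate the sides of 0, because the law of the increment
    depends on the side.\<close>
  define a where "a = expectation (\<lambda>\<omega>. indicator {..0} (S \<omega>) * u1 \<bar>S \<omega>\<bar>)"
  define a' where "a' = expectation (\<lambda>\<omega>. indicator {0<..} (S \<omega>) * u1 \<bar>S \<omega>\<bar>)"
  define b where "b = expectation (\<lambda>\<omega>. indicator {..0} (S \<omega>) * u2 \<bar>S \<omega>\<bar>)"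
  define b' where "b' = expectation (\<lambda>\<omega>. indicator {0<..} (S \<omega>) * u2 \<bar>S \<omega>\<bar>)"
  have bi: "integrable M (\<lambda>\<omega>. indicator A (S \<omega>) * f \<bar>S \<omega>\<bar>)" "integrable M (\<lambda>\<omega>. f \<bar>S \<omega>\<bar>)"
    if "\<And>x. \<bar>f x\<bar> \<le> C" and [measurable]: "f \<in> borel_measurable borel" "A \<in> sets borel"
    for f :: "real \<Rightarrow> real" and A C
  proof -
    have "0 \<le> C" using that(1)[of 0] by linarith
    then show "integrable M (\<lambda>\<omega>. indicator A (S \<omega>) * f \<bar>S \<omega>\<bar>)"
      using that(1) by (intro integrable_const_bound[of _ C]) (auto split: split_indicator)
    show "integrable M (\<lambda>\<omega>. f \<bar>S \<omega>\<bar>)"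
      using that(1) by (intro integrable_const_bound[of _ C]) auto
  qed
  have iv: "indep_var borel (\<lambda>\<omega>. F (S \<omega>)) borel (\<lambda>\<omega>. G (\<xi> \<omega>))"
    if "indep_var borel S borel \<xi>" "F \<in> borel_measurable borel" "G \<in> borel_measurable borel"
    for F G :: "real \<Rightarrow> real" and \<xi>
    using indep_var_compose[OF that(1), of F borel G borel] that by (simp add: comp_def)
  have prodE: "expectation (\<lambda>\<omega>. (indicator A (S \<omega>) * f \<bar>S \<omega>\<bar>) * G (\<xi> \<omega>)) =
      expectation (\<lambda>\<omega>. indicator A (S \<omega>) * f \<bar>S \<omega>\<bar>) * expectation (\<lambda>\<omega>. G (\<xi> \<omega>))"
    "integrable M (\<lambda>\<omega>. (indicator A (S \<omega>) * f \<bar>S \<omega>\<bar>) * G (\<xi> \<omega>))"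
    if "indep_var borel S borel \<xi>" "\<And>x. \<bar>f x\<bar> \<le> C" and [measurable]: "f \<in> borel_measurable borel" "A \<in> sets borel"
      "G \<in> borel_measurable borel" and "integrable M (\<lambda>\<omega>. G (\<xi> \<omega>))"
    for f G :: "real \<Rightarrow> real" and A C \<xi>
  proof -
    have I: "indep_var borel (\<lambda>\<omega>. indicator A (S \<omega>) * f \<bar>S \<omega>\<bar>) borel (\<lambda>\<omega>. G (\<xi> \<omega>))"
      by (rule iv[OF that(1), of "\<lambda>s. indicator A s * f \<bar>s\<bar>" G]) measurable
    show "expectation (\<lambda>\<omega>. (indicator A (S \<omega>) * f \<bar>S \<omega>\<bar>) * G (\<xi> \<omega>)) =
      expectation (\<lambda>\<omega>. indicator A (S \<omega>) * f \<bar>S \<omega>\<bar>) * expectation (\<lambda>\<omega>. G (\<xi> \<omega>))"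
      by (rule indep_var_lebesgue_integral[OF I bi(1)[OF that(2,3,4)] that(6)])
    show "integrable M (\<lambda>\<omega>. (indicator A (S \<omega>) * f \<bar>S \<omega>\<bar>) * G (\<xi> \<omega>))"
      by (rule indep_var_integrable[OF I bi(1)[OF that(2,3,4)] that(6)])
  qed
  define m where "m x = min (\<bar>x\<bar> ^ 3) (x\<^sup>2)" for x :: real
  have mint: "integrable M (\<lambda>\<omega>. m (\<xi>1 \<omega>))" "integrable M (\<lambda>\<omega>. m (\<xi>2 \<omega>))"
    unfolding m_def by (rule Bochner_Integration.integrable_bound[OF sq(1)] Bochner_Integration.integrable_bound[OF sq(2)]; auto)+
  have m0: "m x \<ge> 0" for x by (simp add: m_def)
  \<comment> \<open>\<open>Q\<close> is the second-order Taylor polynomial of the step;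
    \<open>P\<close> below is the generator applied to \<open>u\<close>, times \<open>h\<close>.
    Their means differ only through the variance error \<open>e\<close>.\<close>
  define Q where "Q \<omega> = - (indicator {..0} (S \<omega>) * u1 \<bar>S \<omega>\<bar> * \<xi>1 \<omega>) + indicator {0<..} (S \<omega>) * u1 \<bar>S \<omega>\<bar> * \<xi>2 \<omega>
     + (indicator {..0} (S \<omega>) * u2 \<bar>S \<omega>\<bar> * (\<xi>1 \<omega>)\<^sup>2 + indicator {0<..} (S \<omega>) * u2 \<bar>S \<omega>\<bar> * (\<xi>2 \<omega>)\<^sup>2) / 2" for \<omega>
  define E1 E2 where "E1 = expectation (\<lambda>\<omega>. (\<xi>1 \<omega>)\<^sup>2)" and "E2 = expectation (\<lambda>\<omega>. (\<xi>2 \<omega>)\<^sup>2)"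
  have p1i: "integrable M (\<lambda>\<omega>. indicator {..0} (S \<omega>) * u1 \<bar>S \<omega>\<bar> * \<xi>1 \<omega>)"
    
    by (rule prodE(2)[OF ind1, of u1 K "{..0}" "\<lambda>x. x"]) (use bnd(3) int(1) in measurable)
  have p1e: "expectation (\<lambda>\<omega>. indicator {..0} (S \<omega>) * u1 \<bar>S \<omega>\<bar> * \<xi>1 \<omega>) = a * (- \<alpha> * h)"
    unfolding a_def mean(1)[symmetric]
    by (rule prodE(1)[OF ind1, of u1 K "{..0}" "\<lambda>x. x"]) (use bnd(3) int(1) in measurable)
  have p2i: "integrable M (\<lambda>\<omega>. indicator {0<..} (S \<omega>) * u1 \<bar>S \<omega>\<bar> * \<xi>2 \<omega>)"
    
    by (rule prodE(2)[OF ind2, of u1 K "{0<..}" "\<lambda>x. x"]) (use bnd(3) int(2) in measurable)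
  have p2e: "expectation (\<lambda>\<omega>. indicator {0<..} (S \<omega>) * u1 \<bar>S \<omega>\<bar> * \<xi>2 \<omega>) = a' * (\<alpha> * h)"
    unfolding a'_def mean(2)[symmetric]
    by (rule prodE(1)[OF ind2, of u1 K "{0<..}" "\<lambda>x. x"]) (use bnd(3) int(2) in measurable)
  have p3i: "integrable M (\<lambda>\<omega>. indicator {..0} (S \<omega>) * u2 \<bar>S \<omega>\<bar> * (\<xi>1 \<omega>)\<^sup>2)"
    
    by (rule prodE(2)[OF ind1, of u2 K "{..0}" "\<lambda>x. x\<^sup>2"]) (use bnd(4) sq(1) in measurable)
  have p3e: "expectation (\<lambda>\<omega>. indicator {..0} (S \<omega>) * u2 \<bar>S \<omega>\<bar> * (\<xi>1 \<omega>)\<^sup>2) = b * E1"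
    unfolding b_def E1_def
    by (rule prodE(1)[OF ind1, of u2 K "{..0}" "\<lambda>x. x\<^sup>2"]) (use bnd(4) sq(1) in measurable)
  have p4i: "integrable M (\<lambda>\<omega>. indicator {0<..} (S \<omega>) * u2 \<bar>S \<omega>\<bar> * (\<xi>2 \<omega>)\<^sup>2)"
    
    by (rule prodE(2)[OF ind2, of u2 K "{0<..}" "\<lambda>x. x\<^sup>2"]) (use bnd(4) sq(2) in measurable)
  have p4e: "expectation (\<lambda>\<omega>. indicator {0<..} (S \<omega>) * u2 \<bar>S \<omega>\<bar> * (\<xi>2 \<omega>)\<^sup>2) = b' * E2"
    unfolding b'_def E2_def
    by (rule prodE(1)[OF ind2, of u2 K "{0<..}" "\<lambda>x. x\<^sup>2"]) (use bnd(4) sq(2) in measurable)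
  note p = p1i p2i p3i p4i and q = p1e p2e p3e p4e
  have Qint: "integrable M Q"
    unfolding Q_def[abs_def] using p
    by (intro Bochner_Integration.integrable_add Bochner_Integration.integrable_minus integrable_divide_zero) auto
  have QE: "expectation Q = \<alpha> * h * (a + a') + (b * E1 + b' * E2) / 2"
  proof -
    have "expectation Q = - (a * (- \<alpha> * h)) + a' * (\<alpha> * h) + (b * E1 + b' * E2) / 2"
      unfolding Q_def[abs_def] using p by (simp only: q Bochner_Integration.integral_add
        Bochner_Integration.integral_minus Bochner_Integration.integral_divide_zero
        Bochner_Integration.integrable_add Bochner_Integration.integrable_minus integrable_divide_zero simp_thms)
    then show ?thesis by (simp add: algebra_simps)
  qed
  define P where "P \<omega> = (u2 \<bar>S \<omega>\<bar> / 2 + \<alpha> * u1 \<bar>S \<omega>\<bar>) * h" for \<omega>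
  have spl: "expectation (\<lambda>\<omega>. f \<bar>S \<omega>\<bar>) = expectation (\<lambda>\<omega>. indicator {..0} (S \<omega>) * f \<bar>S \<omega>\<bar>) +
      expectation (\<lambda>\<omega>. indicator {0<..} (S \<omega>) * f \<bar>S \<omega>\<bar>)"
    if "\<And>x. \<bar>f x\<bar> \<le> C" and [measurable]: "f \<in> borel_measurable borel" for f :: "real \<Rightarrow> real" and C
  proof -
    have "f \<bar>S \<omega>\<bar> = indicator {..0} (S \<omega>) * f \<bar>S \<omega>\<bar> + indicator {0<..} (S \<omega>) * f \<bar>S \<omega>\<bar>" for \<omega>
      by (simp split: split_indicator)
    then have "expectation (\<lambda>\<omega>. f \<bar>S \<omega>\<bar>) = expectation (\<lambda>\<omega>. indicator {..0} (S \<omega>) * f \<bar>S \<omega>\<bar> + indicator {0<..} (S \<omega>) * f \<bar>S \<omega>\<bar>)"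
      by (rule Bochner_Integration.integral_cong[OF refl])
    then show ?thesis
      by (simp only: Bochner_Integration.integral_add[OF bi(1)[of f C "{..0}", OF that] bi(1)[of f C "{0<..}", OF that]]
        borel_closed borel_open closed_atMost open_greaterThan)
  qed
  have iU: "integrable M (\<lambda>\<omega>. u1 \<bar>S \<omega>\<bar>)" "integrable M (\<lambda>\<omega>. u2 \<bar>S \<omega>\<bar>)"
    "integrable M (\<lambda>\<omega>. u \<bar>S \<omega>\<bar>)" "integrable M (\<lambda>\<omega>. v \<bar>S \<omega>\<bar>)"
    using bi(2)[of u1 K "{}"] bi(2)[of u2 K "{}"] bi(2)[of u B "{}"] bi(2)[of v B "{}"] bnd by simp_all
  have Pint: "integrable M P"
    unfolding P_def[abs_def] using iU by simp
  have spl': "expectation (\<lambda>\<omega>. u1 \<bar>S \<omega>\<bar>) = a + a'" "expectation (\<lambda>\<omega>. u2 \<bar>S \<omega>\<bar>) = b + b'"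
    using spl[of u1 K] spl[of u2 K] bnd by (simp_all add: a_def a'_def b_def b'_def)
  have PE: "expectation P = \<alpha> * h * (a + a') + (b + b') * h / 2"
  proof -
    have "expectation P = ((b + b') / 2 + \<alpha> * (a + a')) * h"
      unfolding P_def[abs_def] using iU by (simp add: spl')
    then show ?thesis by (simp add: algebra_simps)
  qed
  \<comment> \<open>The two indicators are complementary, so a single \<open>K\<close> bounds both
    averages together.\<close>
  have bK: "\<bar>b\<bar> + \<bar>b'\<bar> \<le> K"
  proof -
    have "\<bar>b\<bar> \<le> expectation (\<lambda>\<omega>. indicator {..0} (S \<omega>) * K)" "\<bar>b'\<bar> \<le> expectation (\<lambda>\<omega>. indicator {0<..} (S \<omega>) * K)"
    proof -
      have *: "\<bar>expectation (\<lambda>\<omega>. indicator A (S \<omega>) * u2 \<bar>S \<omega>\<bar>)\<bar> \<le> expectation (\<lambda>\<omega>. indicator A (S \<omega>) * K)"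
        if [measurable]: "A \<in> sets borel" for A
      proof -
        have "expectation (\<lambda>\<omega>. \<bar>indicator A (S \<omega>) * u2 \<bar>S \<omega>\<bar>\<bar>) \<le> expectation (\<lambda>\<omega>. indicator A (S \<omega>) * K)"
          using bi(1)[of u2 K A] bi(1)[of "\<lambda>_. K" K A] bnd(4) K0
          by (intro integral_mono integrable_abs) (auto split: split_indicator)
        then show ?thesis by (rule order_trans[OF integral_abs_bound])
      qed
      show "\<bar>b\<bar> \<le> expectation (\<lambda>\<omega>. indicator {..0} (S \<omega>) * K)" "\<bar>b'\<bar> \<le> expectation (\<lambda>\<omega>. indicator {0<..} (S \<omega>) * K)"
        unfolding b_def b'_def by (rule *; simp)+
    qed
    moreover have "expectation (\<lambda>\<omega>. indicator {..0} (S \<omega>) * K) + expectation (\<lambda>\<omega>. indicator {0<..} (S \<omega>) * K) = K"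
      using spl[of "\<lambda>_. K" K] K0 by (simp add: prob_space)
    ultimately show ?thesis by linarith
  qed
  have "\<bar>expectation Q - expectation P\<bar> = \<bar>(b * (E1 - h) + b' * (E2 - h)) / 2\<bar>"
  proof -
    have "expectation Q - expectation P = (b * (E1 - h) + b' * (E2 - h)) / 2"
      by (simp add: QE PE field_simps)
    then show ?thesis by (rule arg_cong)
  qed
  also have "\<dots> \<le> (\<bar>b\<bar> * e + \<bar>b'\<bar> * e) / 2"
  proof -
    have "\<bar>b * (E1 - h)\<bar> \<le> \<bar>b\<bar> * e" "\<bar>b' * (E2 - h)\<bar> \<le> \<bar>b'\<bar> * e"
      unfolding abs_mult E1_def E2_def by (intro mult_left_mono var; simp)+
    moreover have "\<bar>x\<bar> \<le> p \<Longrightarrow> \<bar>y\<bar> \<le> q \<Longrightarrow> \<bar>(x + y) / 2\<bar> \<le> (p + q) / 2" for x y p q :: real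
      unfolding abs_divide by simp
    ultimately show ?thesis by blast
  qed
  also have "\<dots> \<le> K * e"
  proof -
    have "e \<ge> 0" using var(1) by linarith
    then have "(\<bar>b\<bar> + \<bar>b'\<bar>) * e \<le> K * e" "0 \<le> K * e" using bK K0 by (auto intro: mult_right_mono)
    then show ?thesis by (simp add: algebra_simps)
  qed
  finally have main: "\<bar>expectation Q - expectation P\<bar> \<le> K * e" .
  have uS': "integrable M (\<lambda>\<omega>. u \<bar>S' \<omega>\<bar>)"
    using bnd(1) by (intro integrable_const_bound[of _ B]) auto
  note iS = iU(3,4)
  have tri: "\<bar>a - b - q\<bar> \<le> A \<Longrightarrow> \<bar>v - b - p\<bar> \<le> C \<Longrightarrow> \<bar>a - v - (q - p)\<bar> \<le> A + C"
    for a b q v p A C :: real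
    by linarith
  have "AE \<omega> in M. \<bar>u \<bar>S' \<omega>\<bar> - v \<bar>S \<omega>\<bar> - (Q \<omega> - P \<omega>)\<bar> \<le> K * (m (\<xi>1 \<omega>) + m (\<xi>2 \<omega>)) + K * h\<^sup>2"
    using S'
  proof eventually_elim
    case (elim \<omega>)
    define \<xi> where "\<xi> = (if S \<omega> \<le> 0 then \<xi>1 \<omega> else \<xi>2 \<omega>)"
    have Q: "Q \<omega> = (if S \<omega> \<le> 0 then - u1 (\<bar>S \<omega>\<bar>) else u1 (\<bar>S \<omega>\<bar>)) * \<xi> + u2 (\<bar>S \<omega>\<bar>) / 2 * \<xi>\<^sup>2"
      by (simp add: Q_def \<xi>_def)
    have "\<bar>u (\<bar>S \<omega> + \<xi>\<bar>) - u (\<bar>S \<omega>\<bar>) - Q \<omega>\<bar> \<le> K * m \<xi>"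
      using taylor[of "S \<omega> + \<xi>" "S \<omega>"] unfolding Q m_def by (simp add: algebra_simps)
    \<comment> \<open>Bounding by the errors of both increments removes the dependence on the side;
      this is the origin of the factor 2 before \<open>\<rho>\<close>.\<close>
    also have "\<dots> \<le> K * (m (\<xi>1 \<omega>) + m (\<xi>2 \<omega>))"
      using m0 by (intro mult_left_mono K0) (simp add: \<xi>_def)
    finally have "\<bar>u (\<bar>S \<omega> + \<xi>\<bar>) - u (\<bar>S \<omega>\<bar>) - Q \<omega>\<bar> \<le> K * (m (\<xi>1 \<omega>) + m (\<xi>2 \<omega>))" .
    moreover have "\<bar>v (\<bar>S \<omega>\<bar>) - u (\<bar>S \<omega>\<bar>) - P \<omega>\<bar> \<le> K * h\<^sup>2"
      using time[of "\<bar>S \<omega>\<bar>"] by (simp add: P_def)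
    moreover have "S' \<omega> = S \<omega> + \<xi>"
      using elim by (simp add: \<xi>_def)
    ultimately show ?case using tri by metis
  qed
  then have "expectation (\<lambda>\<omega>. \<bar>u \<bar>S' \<omega>\<bar> - v \<bar>S \<omega>\<bar> - (Q \<omega> - P \<omega>)\<bar>) \<le> expectation (\<lambda>\<omega>. K * (m (\<xi>1 \<omega>) + m (\<xi>2 \<omega>)) + K * h\<^sup>2)"
    using uS' iS Qint Pint mint
    by (intro integral_mono_AE integrable_abs Bochner_Integration.integrable_diff) auto
  also have "\<dots> = K * (expectation (\<lambda>\<omega>. m (\<xi>1 \<omega>)) + expectation (\<lambda>\<omega>. m (\<xi>2 \<omega>))) + K * h\<^sup>2"
    using mint by (simp add: prob_space)
  also have "\<dots> \<le> K * (\<rho> + \<rho>) + K * h\<^sup>2"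
    using third by (intro add_right_mono mult_left_mono add_mono K0) (auto simp: m_def)
  finally have err: "expectation (\<lambda>\<omega>. \<bar>u \<bar>S' \<omega>\<bar> - v \<bar>S \<omega>\<bar> - (Q \<omega> - P \<omega>)\<bar>) \<le> K * (\<rho> + \<rho>) + K * h\<^sup>2" .
  have "expectation (\<lambda>\<omega>. u \<bar>S' \<omega>\<bar>) - expectation (\<lambda>\<omega>. v \<bar>S \<omega>\<bar>) - (expectation Q - expectation P)
      = expectation (\<lambda>\<omega>. u \<bar>S' \<omega>\<bar> - v \<bar>S \<omega>\<bar> - (Q \<omega> - P \<omega>))"
    using uS' iS Qint Pint by simp
  also have "\<bar>\<dots>\<bar> \<le> K * (\<rho> + \<rho>) + K * h\<^sup>2"
    using integral_abs_bound err by (rule order_trans)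
  finally show ?thesis using main by (simp add: algebra_simps)
qed

text \<open>Lindeberg telescoping: each of the \<open>n\<close> steps replaces one time unit
  \<open>1 / n\<close> of the limit process by a step of the walk. The hypotheses \<open>lim\<close>
  say that the error of one step is \<open>o(1/n)\<close>, hence the total vanishes.\<close>

lemma (in prob_space) walk_expectation_refl_cdf:
  fixes S :: "nat \<Rightarrow> nat \<Rightarrow> 'a \<Rightarrow> real" and \<xi>1 \<xi>2 :: "nat \<Rightarrow> nat \<Rightarrow> 'a \<Rightarrow> real" and e \<rho> :: "nat \<Rightarrow> real"
  assumes ind1: "\<And>n m. n > 0 \<Longrightarrow> indep_var borel (S n m) borel (\<xi>1 n m)"
    and ind2: "\<And>n m. n > 0 \<Longrightarrow> indep_var borel (S n m) borel (\<xi>2 n m)"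
    and sq: "\<And>n m. n > 0 \<Longrightarrow> integrable M (\<lambda>\<omega>. (\<xi>1 n m \<omega>)\<^sup>2)" "\<And>n m. n > 0 \<Longrightarrow> integrable M (\<lambda>\<omega>. (\<xi>2 n m \<omega>)\<^sup>2)"
    and S0: "\<And>n \<omega>. n > 0 \<Longrightarrow> S n 0 \<omega> = x"
    and step: "\<And>n m. n > 0 \<Longrightarrow> AE \<omega> in M. S n (Suc m) \<omega> = S n m \<omega> + (if S n m \<omega> \<le> 0 then \<xi>1 n m \<omega> else \<xi>2 n m \<omega>)"
    and mean: "\<And>n m. n > 0 \<Longrightarrow> expectation (\<xi>1 n m) = - \<alpha> * (1 / real n)" "\<And>n m. n > 0 \<Longrightarrow> expectation (\<xi>2 n m) = \<alpha> * (1 / real n)"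
    and var: "\<And>n m. n > 0 \<Longrightarrow> \<bar>expectation (\<lambda>\<omega>. (\<xi>1 n m \<omega>)\<^sup>2) - 1 / real n\<bar> \<le> e n"
       "\<And>n m. n > 0 \<Longrightarrow> \<bar>expectation (\<lambda>\<omega>. (\<xi>2 n m \<omega>)\<^sup>2) - 1 / real n\<bar> \<le> e n"
    and third: "\<And>n m. n > 0 \<Longrightarrow> expectation (\<lambda>\<omega>. min (\<bar>\<xi>1 n m \<omega>\<bar> ^ 3) ((\<xi>1 n m \<omega>)\<^sup>2)) \<le> \<rho> n"
      "\<And>n m. n > 0 \<Longrightarrow> expectation (\<lambda>\<omega>. min (\<bar>\<xi>2 n m \<omega>\<bar> ^ 3) ((\<xi>2 n m \<omega>)\<^sup>2)) \<le> \<rho> n"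
    and lim: "(\<lambda>n. real n * e n) \<longlonglongrightarrow> 0" "(\<lambda>n. real n * \<rho> n) \<longlonglongrightarrow> 0"
    and "\<delta> > 0"
  shows "(\<lambda>n. expectation (\<lambda>\<omega>. refl_cdf \<alpha> s \<delta> \<bar>S n n \<omega>\<bar>)) \<longlonglongrightarrow> refl_cdf \<alpha> s (1 + \<delta>) \<bar>x\<bar>"
proof -
  obtain U1 U2 K where
    U: "\<And>t x y. \<delta> \<le> t \<Longrightarrow> \<bar>refl_cdf \<alpha> s t (\<bar>y\<bar>) - refl_cdf \<alpha> s t (\<bar>x\<bar>)
        - (if x \<le> 0 then - U1 t (\<bar>x\<bar>) else U1 t (\<bar>x\<bar>)) * (y - x) - U2 t (\<bar>x\<bar>) / 2 * (y - x)\<^sup>2\<bar>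
      \<le> K * min (\<bar>y - x\<bar> ^ 3) ((y - x)\<^sup>2)"
    "\<And>t h x. \<delta> \<le> t \<Longrightarrow> h \<ge> 0 \<Longrightarrow>
      \<bar>refl_cdf \<alpha> s (t + h) x - refl_cdf \<alpha> s t x - (U2 t x / 2 + \<alpha> * U1 t x) * h\<bar> \<le> K * h\<^sup>2"
    "\<And>t x. \<delta> \<le> t \<Longrightarrow> \<bar>U2 t x\<bar> \<le> K"
    "\<And>t. \<delta> \<le> t \<Longrightarrow> U1 t \<in> borel_measurable borel"
    "\<And>t. \<delta> \<le> t \<Longrightarrow> U2 t \<in> borel_measurable borel"
    "\<And>t x. \<delta> \<le> t \<Longrightarrow> \<bar>U1 t x\<bar> \<le> K"
    using refl_cdf_regularity[OF \<open>\<delta> > 0\<close>, of \<alpha> s] by blast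
  \<comment> \<open>Walk up to step \<open>m\<close>, then limit process for the remaining time plus
    \<open>\<delta>\<close>. At \<open>m = n\<close> this is the wanted expectation, at
    \<open>m = 0\<close> the start is deterministic and the value is the limit itself.\<close>
  define G where "G n m = expectation (\<lambda>\<omega>. refl_cdf \<alpha> s (\<delta> + real (n - m) / real n) \<bar>S n m \<omega>\<bar>)" for n m
  have stepG: "\<bar>G n (Suc m) - G n m\<bar> \<le> K * (2 * \<rho> n + (1 / real n)\<^sup>2 + e n)" if "m < n" for n m
  proof -
    have n: "n > 0" using that by simp
    define t where "t = \<delta> + real (n - Suc m) / real n"
    have t: "\<delta> \<le> t" by (simp add: t_def)
    have t': "\<delta> + real (n - m) / real n = t + 1 / real n"
      using that by (simp add: t_def of_nat_diff field_simps)
    show ?thesis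
      unfolding G_def t' t_def[symmetric]
      by (rule one_step_error[OF ind1[OF n] ind2[OF n] sq(1)[OF n] sq(2)[OF n] indep_var_rv1[OF ind1[OF n]]
           step[OF n] mean(1)[OF n] mean(2)[OF n] var(1)[OF n] var(2)[OF n] third(1)[OF n] third(2)[OF n]
           borel_measurable_refl_cdf borel_measurable_refl_cdf U(4)[OF t] U(5)[OF t]
           abs_refl_cdf_le abs_refl_cdf_le U(6)[OF t] U(3)[OF t] U(1)[OF t] U(2)[OF t]]) simp
  qed
  have tot: "\<bar>G n n - G n 0\<bar> \<le> K * (2 * (real n * \<rho> n) + 1 / real n + real n * e n)" if "n > 0" for n
  proof -
    have "\<bar>G n n - G n 0\<bar> = \<bar>\<Sum>m<n. G n (Suc m) - G n m\<bar>"
      by (simp add: sum_lessThan_telescope)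
    also have "\<dots> \<le> (\<Sum>m<n. \<bar>G n (Suc m) - G n m\<bar>)" by (rule sum_abs)
    also have "\<dots> \<le> (\<Sum>m<n. K * (2 * \<rho> n + (1 / real n)\<^sup>2 + e n))"
      by (intro sum_mono stepG) auto
    also have "\<dots> = K * (2 * (real n * \<rho> n) + 1 / real n + real n * e n)"
      using that by (simp add: power2_eq_square field_simps)
    finally show ?thesis .
  qed
  have "(\<lambda>n. K * (2 * (real n * \<rho> n) + 1 / real n + real n * e n)) \<longlonglongrightarrow> K * (2 * 0 + 0 + 0)"
    by (intro tendsto_intros lim lim_1_over_n)
  then have b0: "(\<lambda>n. K * (2 * (real n * \<rho> n) + 1 / real n + real n * e n)) \<longlonglongrightarrow> 0"
    by simp
  have "eventually (\<lambda>n. norm (G n n - G n 0) \<le> K * (2 * (real n * \<rho> n) + 1 / real n + real n * e n)) sequentially"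
    using eventually_gt_at_top[of 0] by eventually_elim (use tot in simp)
  from Lim_null_comparison[OF this b0] have "(\<lambda>n. G n n - G n 0) \<longlonglongrightarrow> 0" .
  moreover have "eventually (\<lambda>n. G n n - G n 0 = expectation (\<lambda>\<omega>. refl_cdf \<alpha> s \<delta> \<bar>S n n \<omega>\<bar>) - refl_cdf \<alpha> s (1 + \<delta>) \<bar>x\<bar>) sequentially"
    using eventually_gt_at_top[of 0]
    by eventually_elim (simp add: G_def S0 prob_space add.commute)
  ultimately have "(\<lambda>n. expectation (\<lambda>\<omega>. refl_cdf \<alpha> s \<delta> \<bar>S n n \<omega>\<bar>) - refl_cdf \<alpha> s (1 + \<delta>) \<bar>x\<bar>) \<longlonglongrightarrow> 0"
    by (rule Lim_transform_eventually)
  then show ?thesis by (simp add: LIM_zero_iff)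
qed

text \<open>\<open>f n w\<close> is the increment of the centred process when the reward
  \<open>w\<close> is drawn. Its second moment exceeds \<open>1 / n\<close> by terms of order
  \<open>n\<close> to the power \<open>-3/2\<close> and smaller. The last claim is dominated
  convergence, which needs no more than the second moment of \<open>W\<close>.\<close>

lemma (in prob_space) increment_moments:
  fixes W :: "'a \<Rightarrow> real" and \<beta> \<sigma> :: real
  defines "f \<equiv> \<lambda>n w. (w - \<beta>) / real n + (w - expectation W) / (\<sigma> * sqrt (real n))"
  assumes [measurable]: "random_variable borel W" and W2: "integrable M (\<lambda>\<omega>. (W \<omega>)\<^sup>2)"
    and "\<sigma> > 0" and var: "variance W = \<sigma>\<^sup>2"
  shows "\<And>n. integrable M (\<lambda>\<omega>. (f n (W \<omega>))\<^sup>2)"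
    and "\<And>n. expectation (\<lambda>\<omega>. f n (W \<omega>)) = (expectation W - \<beta>) / real n"
    and "(\<lambda>n. real n * \<bar>expectation (\<lambda>\<omega>. (f n (W \<omega>))\<^sup>2) - 1 / real n\<bar>) \<longlonglongrightarrow> 0"
    and "(\<lambda>n. real n * expectation (\<lambda>\<omega>. min (\<bar>f n (W \<omega>)\<bar> ^ 3) ((f n (W \<omega>))\<^sup>2))) \<longlonglongrightarrow> 0"
proof -
  define \<mu> where "\<mu> = expectation W"
  define g where "g n = 1 / real n + 1 / (\<sigma> * sqrt (real n))" for n
  have f: "f n w = (w - \<mu>) * g n + (\<mu> - \<beta>) / real n" for n w
    unfolding f_def \<mu>_def[symmetric] g_def by (simp add: algebra_simps add_divide_distrib diff_divide_distrib)
  have W1: "integrable M W" by (rule square_integrable_imp_integrable[OF _ W2]) simp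
  have i0: "integrable M (\<lambda>\<omega>. (W \<omega> - \<mu>)\<^sup>2)"
    using W1 W2 by (simp add: power2_diff)
  have v: "expectation (\<lambda>\<omega>. (W \<omega> - \<mu>)\<^sup>2) = \<sigma>\<^sup>2" using var by (simp add: \<mu>_def)
  have z: "expectation (\<lambda>\<omega>. W \<omega> - \<mu>) = 0" using W1 by (simp add: \<mu>_def prob_space)
  have f2: "(f n w)\<^sup>2 = (w - \<mu>)\<^sup>2 * (g n)\<^sup>2 + 2 * g n * ((\<mu> - \<beta>) / real n) * (w - \<mu>) + ((\<mu> - \<beta>) / real n)\<^sup>2" for n w
    unfolding f power2_sum power_mult_distrib by simp
  show I: "integrable M (\<lambda>\<omega>. (f n (W \<omega>))\<^sup>2)" for n
    unfolding f2 using W1 i0 by simp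
  show "expectation (\<lambda>\<omega>. f n (W \<omega>)) = (expectation W - \<beta>) / real n" for n
    unfolding f using W1 z by (simp add: prob_space \<mu>_def)
  have E2: "expectation (\<lambda>\<omega>. (f n (W \<omega>))\<^sup>2) = \<sigma>\<^sup>2 * (g n)\<^sup>2 + ((\<mu> - \<beta>) / real n)\<^sup>2" for n
    unfolding f2 using W1 i0 v z by (simp add: prob_space)
  have "(\<lambda>n. real n * (\<sigma>\<^sup>2 * (g n)\<^sup>2 + ((\<mu> - \<beta>) / real n)\<^sup>2 - 1 / real n)) \<longlonglongrightarrow> 0"
  proof -
    have "eventually (\<lambda>n. \<sigma>\<^sup>2 * (1 / real n) + 2 * \<sigma> * (1 / sqrt (real n)) + (\<mu> - \<beta>)\<^sup>2 * (1 / real n) =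
       real n * (\<sigma>\<^sup>2 * (g n)\<^sup>2 + ((\<mu> - \<beta>) / real n)\<^sup>2 - 1 / real n)) sequentially"
      using eventually_gt_at_top[of 0]
    proof eventually_elim
      case (elim n)
      define r where "r = sqrt (real n)"
      have r: "r > 0" "real n = r\<^sup>2" using elim by (auto simp: r_def)
      show ?case unfolding g_def r_def[symmetric] unfolding r(2) using r(1) \<open>\<sigma> > 0\<close>
        by (simp add: field_simps power2_eq_square)
    qed
    moreover have "(\<lambda>n. \<sigma>\<^sup>2 * (1 / real n) + 2 * \<sigma> * (1 / sqrt (real n)) + (\<mu> - \<beta>)\<^sup>2 * (1 / real n)) \<longlonglongrightarrow>
        \<sigma>\<^sup>2 * 0 + 2 * \<sigma> * 0 + (\<mu> - \<beta>)\<^sup>2 * 0"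
      by (intro tendsto_intros lim_1_over_n) real_asymp
    ultimately show ?thesis by (simp add: Lim_transform_eventually)
  qed
  then have "(\<lambda>n. \<bar>real n * (expectation (\<lambda>\<omega>. (f n (W \<omega>))\<^sup>2) - 1 / real n)\<bar>) \<longlonglongrightarrow> 0"
    unfolding E2 by (rule tendsto_rabs_zero)
  then show "(\<lambda>n. real n * \<bar>expectation (\<lambda>\<omega>. (f n (W \<omega>))\<^sup>2) - 1 / real n\<bar>) \<longlonglongrightarrow> 0"
    by (simp add: abs_mult)
  \<comment> \<open>An envelope of \<open>sqrt (real n) * \<bar>f n w\<bar>\<close> that is free of
    \<open>n\<close>, from \<open>1 / sqrt (real n) \<le> 1\<close>. Its square is the integrable
    majorant; its cube over \<open>sqrt (real n)\<close> gives the pointwise limit.\<close>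
  define B where "B w = \<bar>w - \<mu>\<bar> * (1 + 1 / \<sigma>) + \<bar>\<mu> - \<beta>\<bar>" for w
  have B0: "B w \<ge> 0" for w using \<open>\<sigma> > 0\<close> by (simp add: B_def)
  have fB: "sqrt (real n) * \<bar>f n w\<bar> \<le> B w" if "n > 0" for n w
  proof -
    define r where "r = sqrt (real n)"
    have r: "r \<ge> 1" "real n = r * r" using that by (auto simp: r_def)
    have "r * \<bar>f n w\<bar> = \<bar>(w - \<mu>) * (1 / r + 1 / \<sigma>) + (\<mu> - \<beta>) / r\<bar>"
    proof -
      have "r * f n w = (w - \<mu>) * (1 / r + 1 / \<sigma>) + (\<mu> - \<beta>) / r"
        unfolding f g_def r_def[symmetric] unfolding r(2) using r(1) \<open>\<sigma> > 0\<close> by (simp add: field_simps)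
      then show ?thesis using r by (metis abs_mult abs_of_nonneg order_trans zero_le_one)
    qed
    also have "\<dots> \<le> \<bar>w - \<mu>\<bar> * (1 / r + 1 / \<sigma>) + \<bar>\<mu> - \<beta>\<bar> / r"
      using r \<open>\<sigma> > 0\<close> by (intro order_trans[OF abs_triangle_ineq]) (simp add: abs_mult)
    also have "\<dots> \<le> B w"
    proof -
      have "\<bar>\<mu> - \<beta>\<bar> / r \<le> \<bar>\<mu> - \<beta>\<bar> / 1" using r(1) by (intro divide_left_mono) auto
      moreover have "1 / r \<le> 1" using r(1) by simp
      ultimately show ?thesis
        unfolding B_def by (intro add_mono mult_left_mono) simp_all
    qed
    finally show ?thesis by (simp add: r_def)
  qed
  have B2: "integrable M (\<lambda>\<omega>. (B (W \<omega>))\<^sup>2)"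
    unfolding B_def power2_sum power_mult_distrib power2_abs using W1 i0 by simp
  define G where "G n w = real n * min (\<bar>f n w\<bar> ^ 3) ((f n w)\<^sup>2)" for n w
  have nf: "real n * (f n w)\<^sup>2 \<le> (B w)\<^sup>2" if "n > 0" for n w
  proof -
    have "(sqrt (real n) * \<bar>f n w\<bar>)\<^sup>2 \<le> (B w)\<^sup>2" using fB[OF that] by (intro power_mono) auto
    then show ?thesis by (simp add: power_mult_distrib)
  qed
  have G0: "0 \<le> G n w" for n w by (simp add: G_def)
  have GB: "G n w \<le> (B w)\<^sup>2" for n w
  proof (cases "n = 0")
    case False
    have "G n w \<le> real n * (f n w)\<^sup>2" unfolding G_def by (intro mult_left_mono) auto
    then show ?thesis using nf[of n w] False by simp
  qed (simp add: G_def)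
  have Gl: "(\<lambda>n. G n w) \<longlonglongrightarrow> 0" for w
  proof (rule tendsto_sandwich)
    show "eventually (\<lambda>n. 0 \<le> G n w) sequentially" using G0 by simp
    show "(\<lambda>n. (B w) ^ 3 * (1 / sqrt (real n))) \<longlonglongrightarrow> 0"
    proof -
      have "(\<lambda>n. (B w) ^ 3 * (1 / sqrt (real n))) \<longlonglongrightarrow> (B w) ^ 3 * 0"
        by (intro tendsto_intros) real_asymp
      then show ?thesis by simp
    qed
    show "eventually (\<lambda>n. G n w \<le> (B w) ^ 3 * (1 / sqrt (real n))) sequentially"
      using eventually_gt_at_top[of 0]
    proof eventually_elim
      case (elim n)
      define r where "r = sqrt (real n)"
      have r: "r > 0" "real n = r * r" using elim by (auto simp: r_def)
      have "G n w \<le> real n * \<bar>f n w\<bar> ^ 3" unfolding G_def by (intro mult_left_mono) auto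
      also have "\<dots> = (r * \<bar>f n w\<bar>) ^ 3 / r" unfolding r(2) using r(1) by (simp add: power_mult_distrib power3_eq_cube)
      also have "\<dots> \<le> (B w) ^ 3 / r" using fB[OF elim, of w] r(1) by (intro divide_right_mono power_mono) (auto simp: r_def)
      finally show ?case by (simp add: r_def)
    qed
  qed simp
  have [measurable]: "f n \<in> borel_measurable borel" for n unfolding f_def by measurable
  have "(\<lambda>n. expectation (\<lambda>\<omega>. G n (W \<omega>))) \<longlonglongrightarrow> expectation (\<lambda>\<omega>. 0)"
    by (rule integral_dominated_convergence[OF _ _ B2]) (auto simp: G_def[abs_def] Gl[unfolded G_def] intro!: AE_I2 GB[unfolded G_def])
  then show "(\<lambda>n. real n * expectation (\<lambda>\<omega>. min (\<bar>f n (W \<omega>)\<bar> ^ 3) ((f n (W \<omega>))\<^sup>2))) \<longlonglongrightarrow> 0"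
    by (simp add: G_def)
qed

section \<open>The bandit process\<close>

lemma bounded_of_tendsto_both_ends:
  fixes \<phi> :: "real \<Rightarrow> real"
  assumes cont: "continuous_on UNIV \<phi>" and top: "(\<phi> \<longlongrightarrow> l) at_top" and bot: "(\<phi> \<longlongrightarrow> k) at_bot"
  obtains B where "\<And>x. \<bar>\<phi> x\<bar> \<le> B"
proof -
  have "eventually (\<lambda>x. dist (\<phi> x) l < 1) at_top" "eventually (\<lambda>x. dist (\<phi> x) k < 1) at_bot"
    using top bot by (auto simp: tendsto_iff)
  then obtain a b where a: "\<And>x. x \<ge> a \<Longrightarrow> dist (\<phi> x) l < 1" and b: "\<And>x. x \<le> b \<Longrightarrow> dist (\<phi> x) k < 1"
    unfolding eventually_at_top_linorder eventually_at_bot_linorder by blast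
  have "bounded (\<phi> ` {b..a})"
    by (intro compact_imp_bounded compact_continuous_image continuous_on_subset[OF cont]) auto
  then obtain C where "\<forall>y\<in>\<phi> ` {b..a}. norm y \<le> C"
    unfolding bounded_iff by blast
  then have C: "\<bar>\<phi> x\<bar> \<le> C" if "x \<in> {b..a}" for x
    using that by auto
  show thesis
  proof
    fix x
    show "\<bar>\<phi> x\<bar> \<le> max C (\<bar>l\<bar> + 1 + (\<bar>k\<bar> + 1))"
    proof -
      consider "x \<ge> a" | "x \<le> b" | "x \<in> {b..a}" by fastforce
      then show ?thesis
      proof cases
        case 1
        then show ?thesis using a[of x] unfolding dist_real_def le_max_iff_disj by linarith
      next
        case 2
        then show ?thesis using b[of x] unfolding dist_real_def le_max_iff_disj by linarith
      next
        case 3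
        then show ?thesis using C[of x] unfolding le_max_iff_disj by blast
      qed
    qed
  qed
qed

section \<open>Joint independence of the rewards of both arms\<close>

context two_armed_bandit
begin

definition arm :: "bool \<times> nat \<Rightarrow> 'a \<Rightarrow> real" where
  "arm = (\<lambda>(b, i). if b then XL i else XR i)"

definition arm_events :: "bool \<times> nat \<Rightarrow> 'a set set" where
  "arm_events j = {arm j -` A \<inter> space M | A. A \<in> sets borel}"

text \<open>Contains the rewards of both arms, drawn or not. It is larger than the history of any
  admissible strategy and does not depend on the strategy, so independence of the next round can be
  read off from disjoint index sets.\<close>

definition past :: "nat \<Rightarrow> 'a measure" where
  "past m = sigma (space M) (\<Union>j\<in>UNIV \<times> {1..m}. arm_events j)"

lemma arm_measurable [measurable]:
  assumes "1 \<le> i"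
  shows "random_variable borel (XL i)" "random_variable borel (XR i)" "random_variable borel (arm (b, i))"
  using XL_indep XR_indep assms unfolding indep_vars_def arm_def by auto

lemma arm_events_subset: "1 \<le> i \<Longrightarrow> arm_events (b, i) \<subseteq> events"
  unfolding arm_events_def by (auto intro: measurable_sets arm_measurable)

text \<open>A finite set of (arm, round) pairs splits into its left and right part. Independence of
  the two sequences factors the probability across the arms, independence inside each sequence
  factors it further.\<close>

lemma indep_arm_events: "indep_sets arm_events (UNIV \<times> {1..})"
proof (rule indep_setsI)
  show "arm_events j \<subseteq> events" if "j \<in> UNIV \<times> {1..}" for j
    using that arm_events_subset by auto
next
  fix A J assume J: "J \<noteq> {}" "J \<subseteq> UNIV \<times> {1..}" "finite J" "\<forall>j\<in>J. A j \<in> arm_events j"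
  then obtain B where B: "\<And>j. j \<in> J \<Longrightarrow> B j \<in> sets borel" "\<And>j. j \<in> J \<Longrightarrow> A j = arm j -` B j \<inter> space M"
    unfolding arm_events_def by simp metis
  define K where "K b = {i. (b, i) \<in> J}" for b
  have K: "finite (K b)" "K b \<subseteq> {1..}" for b
  proof -
    have "K b = snd ` (J \<inter> {b} \<times> UNIV)" by (force simp: K_def)
    then show "finite (K b)" using J by simp
    show "K b \<subseteq> {1..}" using J(2) by (auto simp: K_def)
  qed
  have J_eq: "J = (\<Union>b. (\<lambda>i. (b, i)) ` K b)" by (auto simp: K_def)
  \<comment> \<open>A comprehension instead of an intersection, so that an arm without rounds in
    \<open>J\<close> contributes the whole space.\<close>
  define E where "E b = {\<omega> \<in> space M. \<forall>i\<in>K b. arm (b, i) \<omega> \<in> B (b, i)}" for b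
  have split: "(\<Inter>j\<in>J. A j) = E True \<inter> E False"
  proof -
    have "(\<Inter>j\<in>J. A j) = {\<omega> \<in> space M. \<forall>j\<in>J. arm j \<omega> \<in> B j}"
      using J(1) B(2) by auto
    also have "\<dots> = E True \<inter> E False"
      unfolding J_eq E_def by (auto simp: UNIV_bool)
    finally show ?thesis .
  qed
  have prE: "prob (E b) = (\<Prod>i\<in>K b. prob (A (b, i)))" for b
  proof (cases "K b = {}")
    case True
    then show ?thesis by (simp add: E_def prob_space)
  next
    case False
    have Bm: "B (b, i) \<in> sets borel" "A (b, i) = arm (b, i) -` B (b, i) \<inter> space M" if "i \<in> K b" for i
      using that B by (auto simp: K_def)
    have ind: "indep_vars (\<lambda>_. borel) (\<lambda>i. arm (b, i)) {1..}"
      using XL_indep XR_indep by (cases b) (simp_all add: arm_def)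
    have "E b = (\<Inter>i\<in>K b. arm (b, i) -` B (b, i) \<inter> space M)"
      using False by (auto simp: E_def)
    then show ?thesis
      using indep_varsD[OF ind False K, of "\<lambda>i. B (b, i)"] Bm by simp
  qed
  have "prob (E True \<inter> E False) = prob (E True) * prob (E False)"
  proof -
    \<comment> \<open>Independence is given for the sequences as random elements of the product
      space; the cylinders \<open>?C\<close> are the measurable sets there whose preimages are the
      events \<open>E\<close>.\<close>
    let ?X = "\<lambda>b \<omega>. \<lambda>i\<in>{1..}. arm (b, i) \<omega>"
    let ?C = "\<lambda>b. {f \<in> space (Pi\<^sub>M {1..} (\<lambda>_. borel)). \<forall>i\<in>K b. f i \<in> B (b, i)}"
    have C: "?C b \<in> sets (Pi\<^sub>M {1..} (\<lambda>_. borel))" for b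
    proof (rule sets.sets_Collect_finite_All[OF _ K(1)])
      fix i assume "i \<in> K b"
      then have "i \<in> {1..}" "B (b, i) \<in> sets borel" using K(2)[of b] B(1) by (auto simp: K_def)
      then show "{f \<in> space (Pi\<^sub>M {1..} (\<lambda>_. borel)). f i \<in> B (b, i)} \<in> sets (Pi\<^sub>M {1..} (\<lambda>_. borel))"
        by measurable
    qed
    have ind: "indep_var (Pi\<^sub>M {1..} (\<lambda>_. borel)) (?X True) (Pi\<^sub>M {1..} (\<lambda>_. borel)) (?X False)"
      using XL_XR_indep by (simp add: arm_def)
    have Xe: "?X b -` ?C b \<inter> space M = E b" for b
      using K(2)[of b] by (auto simp: E_def space_PiM)
    have "(\<lambda>x. (?X True x, ?X False x)) -` (?C True \<times> ?C False) \<inter> space M = E True \<inter> E False"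
      unfolding Xe[symmetric] by auto
    then show ?thesis
      using indep_varD[OF ind C[of True] C[of False]] unfolding Xe by simp
  qed
  also have "\<dots> = (\<Prod>j\<in>J. prob (A j))"
  proof -
    have "(\<Prod>j\<in>J. prob (A j)) = (\<Prod>j\<in>Pair True ` K True. prob (A j)) * (\<Prod>j\<in>Pair False ` K False. prob (A j))"
    proof -
      have "J = Pair True ` K True \<union> Pair False ` K False" unfolding J_eq by (auto simp: UNIV_bool)
      then show ?thesis using K by (subst prod.union_disjoint[symmetric]) auto
    qed
    moreover have "(\<Prod>j\<in>Pair b ` K b. prob (A j)) = (\<Prod>i\<in>K b. prob (A (b, i)))" for b
      by (subst prod.reindex) (auto simp: inj_on_def)
    ultimately show ?thesis by (simp only: prE)
  qed
  finally show "prob (\<Inter>j\<in>J. A j) = (\<Prod>j\<in>J. prob (A j))" unfolding split .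
qed

section \<open>The filtration of all rewards, the observed histories and conditional means\<close>

lemma space_past [simp]: "space (past m) = space M"
  unfolding past_def by (rule space_measure_of) (auto simp: arm_events_def)

lemma sets_past: "sets (past m) = sigma_sets (space M) (\<Union>j\<in>UNIV \<times> {1..m}. arm_events j)"
  unfolding past_def by (rule sets_measure_of) (auto simp: arm_events_def)

lemma past_subset: "sets (past m) \<subseteq> events"
proof -
  have "arm_events j \<subseteq> events" if "j \<in> UNIV \<times> {1..m}" for j
    using that arm_events_subset[of "snd j" "fst j"] by auto
  then show ?thesis
    unfolding sets_past by (intro sets.sigma_sets_subset UN_least)
qed

lemma past_mono: "k \<le> m \<Longrightarrow> sets (past k) \<subseteq> sets (past m)"
  unfolding sets_past by (intro sigma_sets_mono' UN_mono) auto

lemma arm_measurable_past: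
  assumes "1 \<le> i" "i \<le> m"
  shows "arm (b, i) \<in> borel_measurable (past m)"
proof (rule measurableI)
  fix A :: "real set" assume "A \<in> sets borel"
  then show "arm (b, i) -` A \<inter> space (past m) \<in> sets (past m)"
    unfolding space_past sets_past using assms
    by (intro sigma_sets.Basic UN_I[where a="(b, i)"]) (auto simp: arm_events_def)
qed simp

text \<open>The index blocks of the first \<open>m\<close> rounds and of the single pair
  \<open>(b, Suc m)\<close> are disjoint, and events of one reward are closed under intersection, so
  the generated sigma-algebras are independent.\<close>

lemma indep_var_past:
  assumes Y: "Y \<in> borel_measurable (past m)"
  shows "indep_var borel Y borel (arm (b, Suc m))"
  unfolding indep_var_eq
proof (intro conjI)
  have "Y \<in> borel_measurable M"
    using Y past_subset by (auto simp: measurable_def)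
  then show "random_variable borel Y" "random_variable borel (arm (b, Suc m))"
    using arm_measurable by auto
  let ?I = "\<lambda>k. if k then UNIV \<times> {1..m} else {(b, Suc m)}"
  have "indep_sets (\<lambda>k. sigma_sets (space M) (\<Union>j\<in>?I k. arm_events j)) UNIV"
  proof (rule indep_sets_collect_sigma)
    show "indep_sets arm_events (\<Union>k. ?I k)"
      by (rule indep_sets_mono_index[OF _ indep_arm_events]) (auto split: if_splits)
    show "Int_stable (arm_events i)" for i
      unfolding arm_events_def Int_stable_def
    proof (safe)
      fix A B :: "real set" assume "A \<in> sets borel" "B \<in> sets borel"
      then show "\<exists>C. arm i -` A \<inter> space M \<inter> (arm i -` B \<inter> space M) = arm i -` C \<inter> space M \<and> C \<in> sets borel"
        by (intro exI[of _ "A \<inter> B"]) auto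
    qed
    show "disjoint_family_on ?I UNIV"
      by (auto simp: disjoint_family_on_def)
  qed
  then show "indep_set (sigma_sets (space M) {Y -` A \<inter> space M |A. A \<in> sets borel})
     (sigma_sets (space M) {arm (b, Suc m) -` A \<inter> space M |A. A \<in> sets borel})"
    unfolding indep_set_def
  proof (rule indep_sets_mono_sets)
    fix k :: bool
    have "sigma_sets (space M) {Y -` A \<inter> space M |A. A \<in> sets borel} \<subseteq> sets (past m)"
    proof -
      have "{Y -` A \<inter> space M |A. A \<in> sets borel} \<subseteq> sets (past m)"
        using measurable_sets[OF Y] by auto
      from sets.sigma_sets_subset[OF this] show ?thesis by simp
    qed
    then show "case_bool (sigma_sets (space M) {Y -` A \<inter> space M |A. A \<in> sets borel})
        (sigma_sets (space M) {arm (b, Suc m) -` A \<inter> space M |A. A \<in> sets borel}) k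
      \<subseteq> sigma_sets (space M) (\<Union>j\<in>?I k. arm_events j)"
      by (cases k) (auto simp: sets_past arm_events_def)
  qed
qed

text \<open>Strong induction: the choice in round \<open>i\<close> is measurable for the history of
  fewer rounds, hence for \<open>past m\<close>, and the reward is selected by it from two variables
  that are measurable for \<open>past m\<close>.\<close>

lemma history_subset_past:
  assumes "admissible M XL XR \<theta>"
  shows "sets (history M XL XR \<theta> m) \<subseteq> sets (past m)"
proof (induction m rule: less_induct)
  case (less m)
  have "reward XL XR \<theta> i \<in> borel_measurable (past m)" if i: "1 \<le> i" "i \<le> m" for i
  proof -
    have "\<theta> i \<in> measurable (history M XL XR \<theta> (i - 1)) (count_space {1, 2})"
      using assms i unfolding admissible_def by blast
    moreover have "sets (history M XL XR \<theta> (i - 1)) \<subseteq> sets (past m)"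
    proof -
      have "i - 1 < m" using i by simp
      then show ?thesis using less[of "i - 1"] past_mono[of "i - 1" m] by (meson less_imp_le order_trans)
    qed
    ultimately have \<theta>: "\<theta> i \<in> measurable (past m) (count_space {1, 2})"
      unfolding measurable_def by auto
    have [measurable]: "XL i \<in> borel_measurable (past m)" "XR i \<in> borel_measurable (past m)"
      using arm_measurable_past[OF i, of True] arm_measurable_past[OF i, of False] by (simp_all add: arm_def)
    have "{\<omega> \<in> space (past m). \<theta> i \<omega> = 1} = \<theta> i -` {1} \<inter> space (past m)" by auto
    also have "\<dots> \<in> sets (past m)" by (rule measurable_sets[OF \<theta>]) simp
    finally show ?thesis
      unfolding reward_def[abs_def] by (intro measurable_If) auto
  qed
  then have "{reward XL XR \<theta> i -` A \<inter> space M |A. A \<in> sets borel} \<subseteq> sets (past m)" if "i \<in> {1..m}" for i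
    using that measurable_sets[of "reward XL XR \<theta> i" "past m" borel] by auto
  then have "sigma_sets (space (past m)) (\<Union>i\<in>{1..m}. {reward XL XR \<theta> i -` A \<inter> space M |A. A \<in> sets borel}) \<subseteq> sets (past m)"
    by (intro sets.sigma_sets_subset) blast
  then show ?case unfolding sets_history by simp
qed

lemma integral_arm:
  assumes "1 \<le> i" and [measurable]: "g \<in> borel_measurable borel"
  shows "expectation (\<lambda>\<omega>. g (XL i \<omega>) :: real) = expectation (\<lambda>\<omega>. g (WL \<omega>))"
    and "expectation (\<lambda>\<omega>. g (XR i \<omega>) :: real) = expectation (\<lambda>\<omega>. g (WR \<omega>))"
    and "integrable M (\<lambda>\<omega>. g (XL i \<omega>) :: real) = integrable M (\<lambda>\<omega>. g (WL \<omega>))"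
    and "integrable M (\<lambda>\<omega>. g (XR i \<omega>) :: real) = integrable M (\<lambda>\<omega>. g (WR \<omega>))"
proof -
  note [measurable] = WL_rv WR_rv arm_measurable[OF assms(1)]
  show "expectation (\<lambda>\<omega>. g (XL i \<omega>)) = expectation (\<lambda>\<omega>. g (WL \<omega>))"
    using integral_distr[of "XL i" M borel g] integral_distr[of WL M borel g] XL_copies[OF assms(1)] by simp
  show "expectation (\<lambda>\<omega>. g (XR i \<omega>)) = expectation (\<lambda>\<omega>. g (WR \<omega>))"
    using integral_distr[of "XR i" M borel g] integral_distr[of WR M borel g] XR_copies[OF assms(1)] by simp
  show "integrable M (\<lambda>\<omega>. g (XL i \<omega>)) = integrable M (\<lambda>\<omega>. g (WL \<omega>))"
    using integrable_distr_eq[of "XL i" M borel g] integrable_distr_eq[of WL M borel g] XL_copies[OF assms(1)] by simp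
  show "integrable M (\<lambda>\<omega>. g (XR i \<omega>)) = integrable M (\<lambda>\<omega>. g (WR \<omega>))"
    using integrable_distr_eq[of "XR i" M borel g] integrable_distr_eq[of WR M borel g] XR_copies[OF assms(1)] by simp
qed

text \<open>The choice event \<open>T\<close> lies in the history, so an integral over a history
  event \<open>A\<close> splits into \<open>A \<inter> T\<close> and \<open>A - T\<close>. On each
  part the fresh reward is independent of the event and may be replaced by its mean.\<close>

lemma real_cond_exp_reward:
  assumes adm: "admissible M XL XR \<theta>"
  shows "AE \<omega> in M. real_cond_exp M (history M XL XR \<theta> m) (reward XL XR \<theta> (Suc m)) \<omega>
    = (if \<theta> (Suc m) \<omega> = 1 then expectation WL else expectation WR)"
proof -
  let ?H = "history M XL XR \<theta> m" and ?Z = "reward XL XR \<theta> (Suc m)"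
  let ?g = "\<lambda>\<omega>. if \<theta> (Suc m) \<omega> = 1 then expectation WL else expectation WR"
  have HM: "sets ?H \<subseteq> events" using history_subset_past[OF adm] past_subset by blast
  have sub: "subalgebra M ?H" using HM by (simp add: subalgebra_def)
  have "finite_measure_subalgebra M ?H"
    by (intro finite_measure_subalgebra.intro finite_measure_subalgebra_axioms.intro sub) unfold_locales
  then interpret H: sigma_finite_subalgebra M ?H
    by (rule finite_measure_subalgebra_is_sigma_finite)
  have \<theta>: "\<theta> (Suc m) \<in> measurable ?H (count_space {1, 2})"
    using adm unfolding admissible_def by (metis diff_Suc_1 le_add1 plus_1_eq_Suc)
  define T where "T = {\<omega> \<in> space M. \<theta> (Suc m) \<omega> = 1}"
  have T: "T \<in> sets ?H"
  proof -
    have "T = \<theta> (Suc m) -` {1} \<inter> space ?H" by (auto simp: T_def)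
    then show ?thesis using measurable_sets[OF \<theta>, of "{1}"] by simp
  qed
  have gm: "?g \<in> borel_measurable ?H"
  proof (rule measurable_If)
    show "{\<omega> \<in> space ?H. \<theta> (Suc m) \<omega> = 1} \<in> sets ?H" using T by (simp add: T_def)
  qed auto
  note [measurable] = arm_measurable[of "Suc m"]
  have iL: "integrable M (XL (Suc m))" and iR: "integrable M (XR (Suc m))"
    using integral_arm(3,4)[of "Suc m" "\<lambda>x. x"] WL_mean WR_mean by simp_all
  have eL: "expectation (XL (Suc m)) = expectation WL" and eR: "expectation (XR (Suc m)) = expectation WR"
    using integral_arm(1,2)[of "Suc m" "\<lambda>x. x"] by simp_all
  have ind: "indep_var borel (indicator A :: _ \<Rightarrow> real) borel (XL (Suc m))"
    "indep_var borel (indicator A :: _ \<Rightarrow> real) borel (XR (Suc m))" if "A \<in> sets ?H" for A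
  proof -
    have "A \<in> sets (past m)" using that history_subset_past[OF adm] by blast
    then have "(indicator A :: _ \<Rightarrow> real) \<in> borel_measurable (past m)" by simp
    from indep_var_past[OF this, of True] indep_var_past[OF this, of False]
    show "indep_var borel (indicator A :: _ \<Rightarrow> real) borel (XL (Suc m))"
      "indep_var borel (indicator A :: _ \<Rightarrow> real) borel (XR (Suc m))"
      by (simp_all add: arm_def)
  qed
  have ii: "integrable M (indicator A :: _ \<Rightarrow> real)" if "A \<in> sets ?H" for A
    using that HM by (auto simp: less_top[symmetric])
  have em: "expectation (indicator A) = prob A" if "A \<in> sets ?H" for A
  proof -
    have "A \<inter> space M = A" using that HM sets.sets_into_space by blast
    then show ?thesis by (simp only: Bochner_Integration.integral_indicator)
  qed
  have pr: "integrable M (\<lambda>\<omega>. indicator A \<omega> * XL (Suc m) \<omega>)" "integrable M (\<lambda>\<omega>. indicator A \<omega> * XR (Suc m) \<omega>)"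
    "expectation (\<lambda>\<omega>. indicator A \<omega> * XL (Suc m) \<omega>) = prob A * expectation WL"
    "expectation (\<lambda>\<omega>. indicator A \<omega> * XR (Suc m) \<omega>) = prob A * expectation WR"
    if "A \<in> sets ?H" for A
    using indep_var_lebesgue_integral[OF ind(1)[OF that] ii[OF that] iL] indep_var_lebesgue_integral[OF ind(2)[OF that] ii[OF that] iR]
      indep_var_integrable[OF ind(1)[OF that] ii[OF that] iL] indep_var_integrable[OF ind(2)[OF that] ii[OF that] iR]
    by (simp_all only: eL eR em[OF that])
  have split: "indicator A \<omega> * ?Z \<omega> = indicator (A \<inter> T) \<omega> * XL (Suc m) \<omega> + indicator (A - T) \<omega> * XR (Suc m) \<omega>"
    "indicator A \<omega> * ?g \<omega> = indicator (A \<inter> T) \<omega> * expectation WL + indicator (A - T) \<omega> * expectation WR"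
    if "\<omega> \<in> space M" for \<omega> A
    using that by (auto simp: reward_def T_def split: split_indicator)
  have AT: "A \<inter> T \<in> sets ?H" "A - T \<in> sets ?H" if "A \<in> sets ?H" for A
    using that T by auto
  have sp: "space M \<in> sets ?H" using sets.top[of ?H] by simp
  show ?thesis
  proof (rule H.real_cond_exp_charact[OF _ _ _ gm])
    show "(\<integral>x\<in>A. ?Z x \<partial>M) = (\<integral>x\<in>A. ?g x \<partial>M)" if A: "A \<in> sets ?H" for A
    proof -
      have "(\<integral>x\<in>A. ?Z x \<partial>M) = expectation (\<lambda>\<omega>. indicator (A \<inter> T) \<omega> * XL (Suc m) \<omega> + indicator (A - T) \<omega> * XR (Suc m) \<omega>)"
        unfolding set_lebesgue_integral_def real_scaleR_def by (intro Bochner_Integration.integral_cong refl split(1))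
      also have "\<dots> = prob (A \<inter> T) * expectation WL + prob (A - T) * expectation WR"
        using pr[OF AT(1)[OF A]] pr[OF AT(2)[OF A]] by simp
      also have "\<dots> = expectation (\<lambda>\<omega>. indicator (A \<inter> T) \<omega> * expectation WL + indicator (A - T) \<omega> * expectation WR)"
        using ii[OF AT(1)[OF A]] ii[OF AT(2)[OF A]] em[OF AT(1)[OF A]] em[OF AT(2)[OF A]] by simp
      also have "\<dots> = (\<integral>x\<in>A. ?g x \<partial>M)"
        unfolding set_lebesgue_integral_def real_scaleR_def by (intro Bochner_Integration.integral_cong refl split(2)[symmetric])
      finally show ?thesis .
    qed
    show "integrable M ?Z"
    proof -
      have "integrable M (\<lambda>\<omega>. indicator (space M \<inter> T) \<omega> * XL (Suc m) \<omega> + indicator (space M - T) \<omega> * XR (Suc m) \<omega>)"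
        using pr[OF AT(1)[OF sp]] pr[OF AT(2)[OF sp]] by simp
      then show ?thesis
        by (rule Bochner_Integration.integrable_cong[THEN iffD1, rotated -1]) (use split(1)[of _ "space M"] in auto)
    qed
    show "integrable M ?g"
      by (rule integrable_const_bound[of _ "max \<bar>expectation WL\<bar> \<bar>expectation WR\<bar>"])
        (use measurable_from_subalg[OF sub gm] in auto)
  qed
qed

text \<open>The two means enter the threshold only through their sum, so no order between the arms
  is assumed: the sign of the drift parameter records which arm is better.\<close>

theorem bandit_limit:
  fixes \<sigma> c \<mu>hi \<mu>lo :: real and \<phi> :: "real \<Rightarrow> real"
  defines "\<theta> \<equiv> \<lambda>n. threshold_strategy M XL XR \<sigma> \<mu>hi \<mu>lo n c"
  assumes "\<sigma> > 0" and var: "variance WL = \<sigma>\<^sup>2" "variance WR = \<sigma>\<^sup>2"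
    and hilo: "\<mu>hi + \<mu>lo = expectation WL + expectation WR"
    and cont: "continuous_on UNIV \<phi>" and sym: "\<And>x. \<phi> (x + c) = \<phi> (- x + c)"
    and bnd: "\<And>x. \<bar>\<phi> x\<bar> \<le> B"
  shows "(\<lambda>n. expectation (\<lambda>\<omega>. \<phi> (bandit_stat M XL XR \<sigma> (\<theta> n) n n \<omega>))) \<longlonglongrightarrow>
    (\<integral>y. \<phi> y \<partial>bandit_distribution ((expectation WR - expectation WL) / 2) ((\<mu>hi + \<mu>lo) / 2) c)"
proof -
  define \<alpha> \<beta> where "\<alpha> = (expectation WR - expectation WL) / 2" and "\<beta> = (\<mu>hi + \<mu>lo) / 2"
  \<comment> \<open>The increments of \<open>S\<close> under the two arms. The shift by
    \<open>\<beta>\<close> stems from the moving threshold, the centred term from the normalised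
    martingale part.\<close>
  define fL where "fL n w = (w - \<beta>) / real n + (w - expectation WL) / (\<sigma> * sqrt (real n))" for n w
  define fR where "fR n w = (w - \<beta>) / real n + (w - expectation WR) / (\<sigma> * sqrt (real n))" for n w
  note mL = increment_moments[OF WL_rv WL_var \<open>\<sigma> > 0\<close> var(1), of \<beta>, folded fL_def]
  note mR = increment_moments[OF WR_rv WR_var \<open>\<sigma> > 0\<close> var(2), of \<beta>, folded fR_def]
  have [measurable]: "fL n \<in> borel_measurable borel" "fR n \<in> borel_measurable borel" for n
    unfolding fL_def[abs_def] fR_def[abs_def] by measurable
  define S where "S n m \<omega> = bandit_stat M XL XR \<sigma> (\<theta> n) m n \<omega> + (1 - real m / real n) * \<beta> - c" for n m \<omega>
  have adm: "admissible M XL XR (\<theta> n)" for n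
    unfolding \<theta>_def by (rule threshold_strategy_admissible)
  have Spast: "S n m \<in> borel_measurable (past m)" for n m
  proof -
    have [measurable]: "bandit_stat M XL XR \<sigma> (\<theta> n) m n \<in> borel_measurable (past m)"
      using bandit_stat_measurable_history[of M XL XR \<sigma> "\<theta> n" m n] history_subset_past[OF adm, of n m]
      by (auto simp: measurable_def)
    show ?thesis unfolding S_def[abs_def] by measurable
  qed
  have \<theta>_n: "threshold_strategy M XL XR \<sigma> \<mu>hi \<mu>lo n c = \<theta> n" for n
    by (simp add: \<theta>_def)
  have rule: "\<theta> n (Suc m) \<omega> = 1 \<longleftrightarrow> S n m \<omega> \<le> 0" for n m \<omega>
    using threshold_strategy_rec[of "Suc m" M XL XR \<sigma> \<mu>hi \<mu>lo n c \<omega>]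
    unfolding \<theta>_n S_def \<beta>_def[symmetric] by (auto split: if_splits)
  have step: "AE \<omega> in M. S n (Suc m) \<omega> = S n m \<omega> + (if S n m \<omega> \<le> 0 then fL n (XL (Suc m) \<omega>) else fR n (XR (Suc m) \<omega>))"
    if n: "n > 0" for n m
    using real_cond_exp_reward[OF adm[of n], of m]
  proof eventually_elim
    case (elim \<omega>)
    let ?Z = "reward XL XR (\<theta> n) (Suc m) \<omega>" and ?E = "if S n m \<omega> \<le> 0 then expectation WL else expectation WR"
    have "bandit_stat M XL XR \<sigma> (\<theta> n) (Suc m) n \<omega> = bandit_stat M XL XR \<sigma> (\<theta> n) m n \<omega>
        + ?Z / real n + (?Z - ?E) / (\<sigma> * sqrt (real n))"
      using elim unfolding bandit_stat_def rule
      by (simp add: algebra_simps add_divide_distrib diff_divide_distrib)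
    moreover have "(1 - real (Suc m) / real n) * \<beta> = (1 - real m / real n) * \<beta> - \<beta> / real n"
      using n by (simp add: field_simps)
    ultimately have "S n (Suc m) \<omega> = S n m \<omega> + ((?Z - \<beta>) / real n + (?Z - ?E) / (\<sigma> * sqrt (real n)))"
      unfolding S_def by (simp add: diff_divide_distrib)
    then show ?case
      unfolding fL_def fR_def reward_def rule by (simp split: if_splits)
  qed
  have ind: "indep_var borel (S n m) borel (\<lambda>\<omega>. fL n (XL (Suc m) \<omega>))"
    "indep_var borel (S n m) borel (\<lambda>\<omega>. fR n (XR (Suc m) \<omega>))" for n m
    using indep_var_compose[OF indep_var_past[OF Spast, of n m True], of "\<lambda>x. x" borel "fL n" borel]
      indep_var_compose[OF indep_var_past[OF Spast, of n m False], of "\<lambda>x. x" borel "fR n" borel]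
    by (simp_all add: arm_def comp_def)
  define EL ER where "EL n = expectation (\<lambda>\<omega>. (fL n (WL \<omega>))\<^sup>2)" and "ER n = expectation (\<lambda>\<omega>. (fR n (WR \<omega>))\<^sup>2)" for n
  define \<rho>L \<rho>R where "\<rho>L n = expectation (\<lambda>\<omega>. min (\<bar>fL n (WL \<omega>)\<bar> ^ 3) ((fL n (WL \<omega>))\<^sup>2))"
    and "\<rho>R n = expectation (\<lambda>\<omega>. min (\<bar>fR n (WR \<omega>)\<bar> ^ 3) ((fR n (WR \<omega>))\<^sup>2))" for n
  have \<rho>0: "\<rho>L n \<ge> 0" "\<rho>R n \<ge> 0" for n
    unfolding \<rho>L_def \<rho>R_def by (intro integral_nonneg_AE; simp)+
  \<comment> \<open>A sum over the arms, since one error bound has to serve both; likewise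
    \<open>\<rho>L n + \<rho>R n\<close>.\<close>
  define e where "e n = \<bar>EL n - 1 / real n\<bar> + \<bar>ER n - 1 / real n\<bar>" for n
  have lim_e: "(\<lambda>n. real n * e n) \<longlonglongrightarrow> 0"
    using tendsto_add[OF mL(3) mR(3)] by (simp add: e_def EL_def ER_def algebra_simps)
  have lim_\<rho>: "(\<lambda>n. real n * (\<rho>L n + \<rho>R n)) \<longlonglongrightarrow> 0"
    using tendsto_add[OF mL(4) mR(4)] by (simp add: \<rho>L_def \<rho>R_def algebra_simps)
  have conv: "(\<lambda>n. expectation (\<lambda>\<omega>. refl_cdf \<alpha> s \<delta> \<bar>S n n \<omega>\<bar>)) \<longlonglongrightarrow> refl_cdf \<alpha> s (1 + \<delta>) \<bar>\<beta> - c\<bar>"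
    if "\<delta> > 0" for \<delta> s
  proof (rule walk_expectation_refl_cdf[where ?\<xi>1.0 = "\<lambda>n m \<omega>. fL n (XL (Suc m) \<omega>)"
        and ?\<xi>2.0 = "\<lambda>n m \<omega>. fR n (XR (Suc m) \<omega>)", OF ind(1) ind(2) _ _ _ step _ _ _ _ _ _ lim_e lim_\<rho> that])
    fix n m :: nat assume n: "n > 0"
    have i: "1 \<le> Suc m" by simp
    show "integrable M (\<lambda>\<omega>. (fL n (XL (Suc m) \<omega>))\<^sup>2)"
      using integral_arm(3)[OF i, of "\<lambda>x. (fL n x)\<^sup>2"] mL(1) by simp
    show "integrable M (\<lambda>\<omega>. (fR n (XR (Suc m) \<omega>))\<^sup>2)"
      using integral_arm(4)[OF i, of "\<lambda>x. (fR n x)\<^sup>2"] mR(1) by simp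
    show "S n 0 \<omega> = \<beta> - c" for \<omega> by (simp add: S_def bandit_stat_def)
    \<comment> \<open>Since \<open>\<beta>\<close> is the average of the two means, the arms have
      opposite drifts of equal size.\<close>
    have b: "expectation WL - \<beta> = - \<alpha>" "expectation WR - \<beta> = \<alpha>"
      using hilo by (simp_all add: \<alpha>_def \<beta>_def field_simps)
    show "expectation (\<lambda>\<omega>. fL n (XL (Suc m) \<omega>)) = - \<alpha> * (1 / real n)"
      using integral_arm(1)[OF i, of "fL n"] mL(2)[of n] b by simp
    show "expectation (\<lambda>\<omega>. fR n (XR (Suc m) \<omega>)) = \<alpha> * (1 / real n)"
      using integral_arm(2)[OF i, of "fR n"] mR(2)[of n] b by simp
    show "\<bar>expectation (\<lambda>\<omega>. (fL n (XL (Suc m) \<omega>))\<^sup>2) - 1 / real n\<bar> \<le> e n"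
      using integral_arm(1)[OF i, of "\<lambda>x. (fL n x)\<^sup>2"] by (simp add: e_def EL_def)
    show "\<bar>expectation (\<lambda>\<omega>. (fR n (XR (Suc m) \<omega>))\<^sup>2) - 1 / real n\<bar> \<le> e n"
      using integral_arm(2)[OF i, of "\<lambda>x. (fR n x)\<^sup>2"] by (simp add: e_def ER_def)
    show "expectation (\<lambda>\<omega>. min (\<bar>fL n (XL (Suc m) \<omega>)\<bar> ^ 3) ((fL n (XL (Suc m) \<omega>))\<^sup>2)) \<le> \<rho>L n + \<rho>R n"
      using integral_arm(1)[OF i, of "\<lambda>x. min (\<bar>fL n x\<bar> ^ 3) ((fL n x)\<^sup>2)"] \<rho>0 by (simp add: \<rho>L_def)
    show "expectation (\<lambda>\<omega>. min (\<bar>fR n (XR (Suc m) \<omega>)\<bar> ^ 3) ((fR n (XR (Suc m) \<omega>))\<^sup>2)) \<le> \<rho>L n + \<rho>R n"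
      using integral_arm(2)[OF i, of "\<lambda>x. min (\<bar>fR n x\<bar> ^ 3) ((fR n x)\<^sup>2)"] \<rho>0 by (simp add: \<rho>R_def)
  qed
  have "(\<lambda>n. expectation (\<lambda>\<omega>. \<phi> (S n n \<omega> + c))) \<longlonglongrightarrow> (\<integral>y. \<phi> y \<partial>bandit_distribution \<alpha> \<beta> c)"
    by (rule expectation_limit_of_refl_cdf[OF indep_var_rv1[OF ind(1)] conv cont sym bnd])
  moreover have "eventually (\<lambda>n. expectation (\<lambda>\<omega>. \<phi> (S n n \<omega> + c)) =
      expectation (\<lambda>\<omega>. \<phi> (bandit_stat M XL XR \<sigma> (\<theta> n) n n \<omega>))) sequentially"
    using eventually_gt_at_top[of 0] by eventually_elim (simp add: S_def)
  ultimately show ?thesis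
    unfolding \<alpha>_def \<beta>_def by (rule Lim_transform_eventually)
qed

end

theorem theorem3p2:
  fixes M :: "'a measure"
    and WL WR :: "'a \<Rightarrow> real"
    and XL XR :: "nat \<Rightarrow> 'a \<Rightarrow> real"
    and \<mu>L \<mu>R \<mu>hi \<mu>lo \<sigma> c :: real
    and \<phi> :: "real \<Rightarrow> real"
  assumes bandit: "two_armed_bandit M WL WR XL XR"
    and \<mu>L: "\<mu>L = prob_space.expectation M WL"
    and \<mu>R: "\<mu>R = prob_space.expectation M WR"
    and \<mu>hi: "\<mu>hi = max \<mu>L \<mu>R"
    and \<mu>lo: "\<mu>lo = min \<mu>L \<mu>R"
    and \<sigma>_pos: "\<sigma> > 0"
    and var_L: "prob_space.variance M WL = \<sigma>\<^sup>2"
    and var_R: "prob_space.variance M WR = \<sigma>\<^sup>2"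
    and \<phi>_cont: "continuous_on UNIV \<phi>"
    and \<phi>_top: "\<exists>l. (\<phi> \<longlongrightarrow> l) at_top"
    and \<phi>_bot: "\<exists>l. (\<phi> \<longlongrightarrow> l) at_bot"
    and \<phi>_sym: "\<forall>x. \<phi> (x + c) = \<phi> (- x + c)"
    and \<phi>_mono: "mono_on {c<..} \<phi> \<or> antimono_on {c<..} \<phi>"
  shows
    "((\<mu>L, \<mu>R) = (\<mu>hi, \<mu>lo) \<longrightarrow>
       (\<lambda>n. prob_space.expectation M (\<lambda>\<omega>.
          \<phi> (bandit_stat M XL XR \<sigma> (threshold_strategy M XL XR \<sigma> \<mu>hi \<mu>lo n c) n n \<omega>)))
       \<longlonglongrightarrow> (\<integral>y. \<phi> y \<partial>bandit_distribution ((\<mu>lo - \<mu>hi) / 2) ((\<mu>hi + \<mu>lo) / 2) c))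
     \<and>
     ((\<mu>L, \<mu>R) = (\<mu>lo, \<mu>hi) \<longrightarrow>
       (\<lambda>n. prob_space.expectation M (\<lambda>\<omega>.
          \<phi> (bandit_stat M XL XR \<sigma> (threshold_strategy M XL XR \<sigma> \<mu>hi \<mu>lo n c) n n \<omega>)))
       \<longlonglongrightarrow> (\<integral>y. \<phi> y \<partial>bandit_distribution ((\<mu>hi - \<mu>lo) / 2) ((\<mu>hi + \<mu>lo) / 2) c))"
proof -
  interpret two_armed_bandit M WL WR XL XR by (rule bandit)
  obtain B where B: "\<And>x. \<bar>\<phi> x\<bar> \<le> B"
    using \<phi>_top \<phi>_bot bounded_of_tendsto_both_ends[OF \<phi>_cont] by metis
  \<comment> \<open>Maximum plus minimum is the sum in either order, so one instance of
    \<open>bandit_limit\<close> yields both cases.\<close>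
  have "\<mu>hi + \<mu>lo = expectation WL + expectation WR"
    unfolding \<mu>hi \<mu>lo \<mu>L \<mu>R by (simp add: max_def min_def)
  from bandit_limit[OF \<sigma>_pos var_L var_R this \<phi>_cont \<phi>_sym[rule_format] B]
  show ?thesis
    unfolding \<mu>L[symmetric] \<mu>R[symmetric] by auto
qed

end
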